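(* Let $\kappa\geq\mathfrak{c}$ be a cardinal number. Suppose that $X$ is a Banach space with $\mathrm{dens}\, X>\exp_3\kappa$. Then $X$ contains a subspace $Y$ with an Auerbach basis and such that $\mathrm{dens}\, Y=\kappa^+$.
   Context: Banach spaces are over the real or the complex field; subspaces are closed. $\mathfrak{c}$ is the cardinality of the continuum, $\kappa^+$ is the successor cardinal of $\kappa$, $\exp_1\kappa=2^\kappa$ and $\exp_{n+1}\kappa=2^{\exp_n\kappa}$. $\mathrm{dens}$ is the density character. An M-basis of $Y$ is a family $\{x_\gamma;x_\gamma^*\}_{\gamma\in\Gamma}\subseteq Y\times Y^*$ with $\langle x_\alpha^*,x_\beta\rangle=\delta_{\alpha,\beta}$, with $\{x_\gamma\}$ having norm-dense linear span in $Y$ and $\{x_\gamma^*\}$ having $w^*$-dense linear span in $Y^*$. An Auerbach basis of $Y$ is an M-basis with $\|x_\gamma\|=\|x^*_\gamma\|=1$ for every $\gamma\in\Gamma$. *)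

theory Defs
  imports "HOL-Analysis.Analysis" "HOL-Library.Function_Algebras"
begin

unbundle cardinal_syntax

text \<open>A scalar multiplication by \<open>'k\<close> (here real or complex) on a normed space. The type class
  supplies only the underlying real normed space, so that for \<open>'k = complex\<close> over a type of class
  \<open>banach\<close> this locale describes the complex Banach spaces.\<close>

locale normed_scaling = vector_space sc
  for sc :: "'k::real_normed_field \<Rightarrow> 'a::real_normed_vector \<Rightarrow> 'a" +
  assumes sc_of_real: "sc (of_real r) x = r *\<^sub>R x"
    and norm_sc: "norm (sc c x) = norm c * norm x"

lemma normed_scaling_scaleR: "normed_scaling (scaleR :: real \<Rightarrow> 'a::real_normed_vector \<Rightarrow> 'a)"
  by unfold_locales (auto simp: algebra_simps)

lemma normed_scaling_complex_mult: "normed_scaling ((*) :: complex \<Rightarrow> complex \<Rightarrow> complex)"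
  by unfold_locales (auto simp: algebra_simps norm_mult scaleR_conv_of_real)


text \<open>Cardinals are represented, as in the BNF library, by well-orders up to \<open>=o\<close>; the choice below
  only selects a representative of the least cardinality of a dense subset of \<open>S\<close>.\<close>

definition dens :: "'a::topological_space set \<Rightarrow> 'a rel" where
  "dens S = (SOME r. (\<exists>D. D \<subseteq> S \<and> S \<subseteq> closure D \<and> r = |D| ) \<and>
                     (\<forall>D. D \<subseteq> S \<and> S \<subseteq> closure D \<longrightarrow> r \<le>o |D| ))"

lemma dens_is_least:
  shows dens_attained: "\<exists>D. D \<subseteq> S \<and> S \<subseteq> closure D \<and> dens S = |D|"
    and dens_le: "\<And>D. D \<subseteq> S \<Longrightarrow> S \<subseteq> closure D \<Longrightarrow> dens S \<le>o |D|"
proof -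
  let ?R = "{ |D| | D. D \<subseteq> S \<and> S \<subseteq> closure D }"
  have "|S| \<in> ?R"
    using closure_subset by blast
  moreover have "\<forall>r\<in>?R. Card_order r"
    by (auto simp: card_of_Card_order)
  ultimately obtain r where r: "r \<in> ?R" "\<forall>r'\<in>?R. r \<le>o r'"
    using exists_minim_Card_order[of ?R] by blast
  have "\<exists>r. (\<exists>D. D \<subseteq> S \<and> S \<subseteq> closure D \<and> r = |D| ) \<and>
            (\<forall>D. D \<subseteq> S \<and> S \<subseteq> closure D \<longrightarrow> r \<le>o |D| )"
    using r by blast
  from someI_ex[OF this] show "\<exists>D. D \<subseteq> S \<and> S \<subseteq> closure D \<and> dens S = |D|"
    and "\<And>D. D \<subseteq> S \<Longrightarrow> S \<subseteq> closure D \<Longrightarrow> dens S \<le>o |D|"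
    unfolding dens_def by blast+
qed


text \<open>The dual of a subspace \<open>Y\<close> of the ambient type. As HOL functions are total, a functional on \<open>Y\<close>
  is represented by the function extending it by zero outside \<open>Y\<close>; nothing about continuity or
  linearity off \<open>Y\<close> is meant by this.\<close>

definition dual_space ::
  "('k::real_normed_field \<Rightarrow> 'a::real_normed_vector \<Rightarrow> 'a) \<Rightarrow> 'a set \<Rightarrow> ('a \<Rightarrow> 'k) set" where
  "dual_space sc Y =
     {f. (\<forall>x\<in>Y. \<forall>y\<in>Y. f (x + y) = f x + f y) \<and>
         (\<forall>c. \<forall>x\<in>Y. f (sc c x) = c * f x) \<and>
         (\<exists>B. \<forall>x\<in>Y. norm (f x) \<le> B * norm x) \<and>
         (\<forall>x. x \<notin> Y \<longrightarrow> f x = 0)}"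

definition dual_norm :: "'a::real_normed_vector set \<Rightarrow> ('a \<Rightarrow> 'k::real_normed_field) \<Rightarrow> real" where
  "dual_norm Y f = (SUP y\<in>{y\<in>Y. norm y \<le> 1}. norm (f y))"

definition weak_star ::
  "('k::real_normed_field \<Rightarrow> 'a::real_normed_vector \<Rightarrow> 'a) \<Rightarrow> 'a set \<Rightarrow> ('a \<Rightarrow> 'k) topology" where
  "weak_star sc Y =
     topology_generated_by {{f \<in> dual_space sc Y. f y \<in> U} | y U. y \<in> Y \<and> open U}"

lemma topspace_weak_star:
  assumes "Y \<noteq> {}"
  shows "topspace (weak_star sc Y) = dual_space sc Y"
  using assms by (auto simp: weak_star_def intro!: exI[of _ UNIV])

definition M_basis ::
  "('k::real_normed_field \<Rightarrow> 'a::real_normed_vector \<Rightarrow> 'a) \<Rightarrow> 'a set \<Rightarrow>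
     'i set \<Rightarrow> ('i \<Rightarrow> 'a) \<Rightarrow> ('i \<Rightarrow> 'a \<Rightarrow> 'k) \<Rightarrow> bool" where
  "M_basis sc Y \<Gamma> x x' \<longleftrightarrow>
     x ` \<Gamma> \<subseteq> Y \<and> x' ` \<Gamma> \<subseteq> dual_space sc Y \<and>
     (\<forall>\<alpha>\<in>\<Gamma>. \<forall>\<beta>\<in>\<Gamma>. x' \<alpha> (x \<beta>) = (if \<alpha> = \<beta> then 1 else 0)) \<and>
     Y \<subseteq> closure (module.span sc (x ` \<Gamma>)) \<and>
     dual_space sc Y \<subseteq>
       weak_star sc Y closure_of (module.span (\<lambda>c f y. c * f y) (x' ` \<Gamma>))"

definition Auerbach_basis ::
  "('k::real_normed_field \<Rightarrow> 'a::real_normed_vector \<Rightarrow> 'a) \<Rightarrow> 'a set \<Rightarrow>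
     'i set \<Rightarrow> ('i \<Rightarrow> 'a) \<Rightarrow> ('i \<Rightarrow> 'a \<Rightarrow> 'k) \<Rightarrow> bool" where
  "Auerbach_basis sc Y \<Gamma> x x' \<longleftrightarrow>
     M_basis sc Y \<Gamma> x x' \<and> (\<forall>\<gamma>\<in>\<Gamma>. norm (x \<gamma>) = 1 \<and> dual_norm Y (x' \<gamma>) = 1)"

text \<open>Biorthogonality makes \<open>x\<close> injective, so the index set may be taken inside the ambient type.\<close>

definition has_Auerbach_basis ::
  "('k::real_normed_field \<Rightarrow> 'a::real_normed_vector \<Rightarrow> 'a) \<Rightarrow> 'a set \<Rightarrow> bool" where
  "has_Auerbach_basis sc Y \<longleftrightarrow> (\<exists>(\<Gamma> :: 'a set) x x'. Auerbach_basis sc Y \<Gamma> x x')"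

lemma has_Auerbach_basisI:
  fixes \<Gamma> :: "'i set"
  assumes "Auerbach_basis sc Y \<Gamma> x x'"
  shows "has_Auerbach_basis sc Y"
proof -
  have inj: "inj_on x \<Gamma>"
  proof (rule inj_onI)
    fix \<alpha> \<beta> assume "\<alpha> \<in> \<Gamma>" "\<beta> \<in> \<Gamma>" "x \<alpha> = x \<beta>"
    then have "x' \<alpha> (x \<beta>) = 1" "x' \<alpha> (x \<beta>) = (if \<alpha> = \<beta> then 1 else 0)"
      using assms unfolding Auerbach_basis_def M_basis_def by metis+
    then show "\<alpha> = \<beta>"
      by (auto split: if_splits)
  qed
  define g where "g = the_inv_into \<Gamma> x"
  have g: "g (x \<gamma>) = \<gamma>" if "\<gamma> \<in> \<Gamma>" for \<gamma>
    using inj that by (simp add: g_def the_inv_into_f_f)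
  have "(x' \<circ> g) ` x ` \<Gamma> = x' ` \<Gamma>"
    using g by (force simp: image_image)
  moreover have "id ` x ` \<Gamma> = x ` \<Gamma>"
    by simp
  ultimately have "Auerbach_basis sc Y (x ` \<Gamma>) id (x' \<circ> g)"
    using assms inj unfolding Auerbach_basis_def M_basis_def
    by (auto simp: g inj_on_eq_iff)
  then show ?thesis
    unfolding has_Auerbach_basis_def by blast
qed

end

theory Submission
  imports Defs
begin

text \<open>
Fix for every vector \<open>z\<close> a norming functional \<open>H z\<close>, that is, one in the dual unit ball with
\<open>H z z = norm z\<close>, and well-order the space. Choose greedily a set \<open>L\<close> of non-zero vectors such that \<open>H u x = 0\<close>
whenever \<open>x \<in> L\<close> and \<open>u\<close> is a combination of elements of \<open>L\<close> before \<open>x\<close>. This process cannot stop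
early: if \<open>L\<close> had at most \<open>exp\<^sub>2 \<kappa>\<close> elements, then a vector would be determined by its values under
\<open>exp\<^sub>2 \<kappa>\<close> functionals, and the space would have at most \<open>exp\<^sub>3 \<kappa>\<close> elements, hence also density at most
\<open>exp\<^sub>3 \<kappa>\<close> (\<open>large_kernel_set\<close>). The elements of \<open>L\<close> form a long monotone basic sequence, since for a combination \<open>u\<close>
of earlier and a combination \<open>v\<close> of later elements \<open>norm u = norm (H u (u + v)) \<le> norm (u + v)\<close>.

For elements \<open>a < b < e\<close> of \<open>L\<close> colour the triple by the scalar \<open>H (b - e) a\<close>. There are at most continuum many
colours, hence at most \<open>\<kappa>\<close>, and more than \<open>exp\<^sub>2 \<kappa>\<close> points, so the Erdos--Rado theorem (\<open>Erdos_Rado_triples\<close>) yields a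
homogeneous set \<open>G\<close> with more than \<open>\<kappa>\<close> elements. Cut \<open>G\<close> into consecutive disjoint pairs \<open>i < s i\<close>, and put
\<open>z i = i - s i\<close>. The functional \<open>H (z i)\<close> kills all later pairs by the choice of \<open>L\<close>, and it kills \<open>z j\<close>
for each earlier \<open>j\<close> because it takes the same value at \<open>j\<close> and at \<open>s j\<close>. Thus the normalised vectors \<open>z i\<close> with the
functionals \<open>H (z i)\<close> are an Auerbach system (\<open>exists_monotone_Auerbach_system\<close>).

It remains to take exactly \<open>\<kappa>\<^sup>+\<close> of the pairs and their closed span \<open>Y\<close>. The coordinate functionals of a monotone
system separate the points of \<open>Y\<close> (\<open>total_on_closed_span\<close>), and a separating space of functionals
is weak-star dense by linear algebra (\<open>weak_star_dense_if_total\<close>). The density of \<open>Y\<close> is \<open>\<kappa>\<^sup>+\<close>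
because the basis vectors have mutual distance at least one and their span has \<open>\<kappa>\<^sup>+\<close> elements
(\<open>dens_closed_span\<close>). The argument uses the scalar field only through its cardinality and the existence of
norming functionals, so the real and the complex case are treated together.
\<close>

section \<open>Norming functionals\<close>

definition sublinear :: "('a::real_vector \<Rightarrow> real) \<Rightarrow> bool" where
  "sublinear p \<longleftrightarrow> (\<forall>x y. p (x + y) \<le> p x + p y) \<and> (\<forall>t x. 0 \<le> t \<longrightarrow> p (t *\<^sub>R x) = t * p x)"

definition lower_along :: "('a::real_vector \<Rightarrow> real) \<Rightarrow> 'a \<Rightarrow> 'a \<Rightarrow> real" where
  "lower_along p a y = (INF t\<in>{0..}. p (y + t *\<^sub>R a) - t * p a)"

lemma sublinear_zero: "sublinear p \<Longrightarrow> p 0 = 0"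
  unfolding sublinear_def by (metis mult_zero_left order_refl scaleR_zero_left)

lemma sublinear_minus_le: "sublinear p \<Longrightarrow> - p (- x) \<le> p x"
  using sublinear_zero[of p] unfolding sublinear_def
  by (smt (verit) add.right_inverse)

text \<open>Forcing a sublinear \<open>p\<close> down to \<open>- p a\<close> at \<open>- a\<close>: the infimum below is again sublinear, lies under
\<open>p\<close>, and the choice \<open>t = 1\<close> shows that it satisfies \<open>lower_along p a y + p a \<le> p (y + a)\<close>.
If \<open>p\<close> is minimal, then \<open>lower_along p a = p\<close> and this inequality makes \<open>p\<close> superadditive.\<close>

lemma
  assumes p: "sublinear p"
  shows sublinear_lower_along: "sublinear (lower_along p a)"
    and lower_along_le: "0 \<le> t \<Longrightarrow> lower_along p a y \<le> p (y + t *\<^sub>R a) - t * p a"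
proof -
  have add: "p (x + y) \<le> p x + p y" and scale: "0 \<le> t \<Longrightarrow> p (t *\<^sub>R x) = t * p x" for x y t
    using p unfolding sublinear_def by auto
  have "- p (- y) \<le> p (y + t *\<^sub>R a) - t * p a" if "0 \<le> t" for t y
    using add[of "y + t *\<^sub>R a" "- y"] scale[OF that, of a] by simp
  then have bdd: "bdd_below ((\<lambda>t. p (y + t *\<^sub>R a) - t * p a) ` {0..})" for y
    by (intro bdd_belowI2) auto
  show le: "lower_along p a y \<le> p (y + t *\<^sub>R a) - t * p a" if "0 \<le> t" for y t
    unfolding lower_along_def using that by (intro cINF_lower bdd) auto
  have greatest: "m \<le> lower_along p a y" if "\<And>t. 0 \<le> t \<Longrightarrow> m \<le> p (y + t *\<^sub>R a) - t * p a" for m y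
    unfolding lower_along_def using that by (intro cINF_greatest) auto
  have "lower_along p a (x + y) \<le> lower_along p a x + lower_along p a y" for x y
  proof -
    \<comment> \<open>Test the infimum at \<open>x + y\<close> with the parameter \<open>s + t\<close>, then take infima over \<open>s\<close> and \<open>t\<close> separately.\<close>
    have sum: "lower_along p a (x + y) \<le> (p (x + s *\<^sub>R a) - s * p a) + (p (y + t *\<^sub>R a) - t * p a)"
      if "0 \<le> s" "0 \<le> t" for s t
      using le[of "s + t" "x + y"] add[of "x + s *\<^sub>R a" "y + t *\<^sub>R a"] that
      by (simp add: algebra_simps)
    have "lower_along p a (x + y) - (p (y + t *\<^sub>R a) - t * p a) \<le> lower_along p a x" if "0 \<le> t" for t
      using sum[OF _ that] by (intro greatest) (simp add: algebra_simps)
    then have "lower_along p a (x + y) - lower_along p a x \<le> lower_along p a y"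
      by (intro greatest) (simp add: algebra_simps)
    then show ?thesis by simp
  qed
  moreover have "lower_along p a (r *\<^sub>R x) = r * lower_along p a x" if "0 \<le> r" for r x
  proof (cases "r = 0")
    case True
    have "0 \<le> lower_along p a 0"
      by (intro greatest) (simp add: scale)
    with le[of 0 0] sublinear_zero[OF p] True show ?thesis by simp
  next
    case False
    with that have r: "r > 0" by simp
    \<comment> \<open>One inequality for all positive scalars suffices: applied to \<open>r\<close> and to its inverse it gives equality.\<close>
    have "lower_along p a (s *\<^sub>R z) \<le> s * lower_along p a z" if s: "s > 0" for s z
    proof -
      have "lower_along p a (s *\<^sub>R z) / s \<le> p (z + t *\<^sub>R a) - t * p a" if "0 \<le> t" for t
      proof -
        have "p (s *\<^sub>R z + (s * t) *\<^sub>R a) = s * p (z + t *\<^sub>R a)"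
          using scale[of s "z + t *\<^sub>R a"] s by (simp add: algebra_simps)
        with le[of "s * t" "s *\<^sub>R z"] s that show ?thesis by (simp add: field_simps)
      qed
      then have "lower_along p a (s *\<^sub>R z) / s \<le> lower_along p a z" by (rule greatest)
      with s show ?thesis by (simp add: field_simps)
    qed
    from this[OF r, of x] this[of "inverse r" "r *\<^sub>R x"] r show ?thesis
      by (simp add: field_simps)
  qed
  ultimately show "sublinear (lower_along p a)" unfolding sublinear_def by blast
qed

text \<open>The Hahn--Banach theorem in the form that minimal sublinear functionals are linear. A minimal one
below \<open>p\<close> exists by Zorn's lemma, since the pointwise infimum of a chain of sublinear functionals is
sublinear; it stays finite because every member is bounded below by \<open>- p (- x)\<close>.\<close>

lemma sublinear_imp_linear_below:
  assumes p0: "sublinear p"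
  shows "\<exists>f. linear f \<and> (\<forall>x. f x \<le> p x)"
proof -
  define A where "A = {q. sublinear q \<and> (\<forall>x. q x \<le> p x)}"
  define P where "P q q' \<longleftrightarrow> (\<forall>x. q' x \<le> q x)" for q q' :: "'a \<Rightarrow> real"
  have "\<exists>u\<in>A. \<forall>a\<in>C. P a u" if C: "C \<in> Chains (relation_of P A)" for C
  proof (cases "C = {}")
    case True then show ?thesis using p0 by (auto simp: A_def)
  next
    case False
    have CA: "C \<subseteq> A" and cmp: "\<And>q q'. q \<in> C \<Longrightarrow> q' \<in> C \<Longrightarrow> P q q' \<or> P q' q"
      using C unfolding Chains_def relation_of_def by auto
    have sub: "sublinear q" and lep: "q x \<le> p x" if "q \<in> C" for q x
      using CA that by (auto simp: A_def)
    have "- p (- x) \<le> q x" if "q \<in> C" for q x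
      using sublinear_minus_le[OF sub[OF that], of x] lep[OF that, of "- x"] by simp
    then have bdd: "bdd_below ((\<lambda>q. q x) ` C)" for x by (intro bdd_belowI2) auto
    define u where "u x = (INF q\<in>C. q x)" for x
    have ule: "u x \<le> q x" if "q \<in> C" for q x
      unfolding u_def using that by (intro cINF_lower bdd)
    have ugr: "m \<le> u x" if "\<And>q. q \<in> C \<Longrightarrow> m \<le> q x" for m x
      unfolding u_def using that False by (intro cINF_greatest)
    have "u (x + y) \<le> u x + u y" for x y
    proof -
      have sum: "u (x + y) \<le> q x + q' y" if q: "q \<in> C" "q' \<in> C" for q q'
      proof -
        obtain q'' where "q'' \<in> C" "q'' x \<le> q x" "q'' y \<le> q' y"
          using cmp[OF q] q unfolding P_def by blast
        then show ?thesis
          using ule[of q'' "x + y"] sub[of q''] unfolding sublinear_def by (smt (verit))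
      qed
      have "u (x + y) - q y \<le> u x" if "q \<in> C" for q
        using sum[OF _ that] by (intro ugr) (simp add: algebra_simps)
      then have "u (x + y) - u x \<le> u y" by (intro ugr) (simp add: algebra_simps)
      then show ?thesis by simp
    qed
    moreover have "u (t *\<^sub>R x) = t * u x" if "0 \<le> t" for t x
    proof -
      have "(\<lambda>q. q (t *\<^sub>R x)) ` C = (\<lambda>q. t * q x) ` C"
        using sub that by (intro image_cong) (auto simp: sublinear_def)
      then have "u (t *\<^sub>R x) = (INF q\<in>C. t * q x)" by (simp add: u_def)
      also have "\<dots> = t * u x"
      proof (cases "t = 0")
        case True with False show ?thesis by simp
      next
        case F: False
        with that have "t > 0" by simp
        show ?thesis
        proof (rule antisym)
          have "(INF q\<in>C. t * q x) / t \<le> u x"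
          proof (rule ugr)
            fix q assume "q \<in> C"
            moreover have "bdd_below ((\<lambda>q. t * q x) ` C)"
              using ule \<open>t > 0\<close> by (intro bdd_belowI2[of _ "t * u x"]) auto
            ultimately have "(INF q\<in>C. t * q x) \<le> t * q x" by (intro cINF_lower)
            with \<open>t > 0\<close> show "(INF q\<in>C. t * q x) / t \<le> q x" by (simp add: field_simps)
          qed
          with \<open>t > 0\<close> show "(INF q\<in>C. t * q x) \<le> t * u x" by (simp add: field_simps)
          show "t * u x \<le> (INF q\<in>C. t * q x)"
            using \<open>t > 0\<close> ule False by (intro cINF_greatest) auto
        qed
      qed
      finally show ?thesis .
    qed
    ultimately have "sublinear u" unfolding sublinear_def by blast
    moreover have "u x \<le> p x" for x using False ule lep order_trans by blast
    ultimately show ?thesis using ule by (auto simp: A_def P_def)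
  qed
  moreover have "partial_order_on A (relation_of P A)"
    by (rule partial_order_on_relation_ofI) (auto simp: P_def fun_eq_iff intro: order_trans antisym)
  ultimately obtain f where f: "f \<in> A" and min: "\<And>q. q \<in> A \<Longrightarrow> P f q \<Longrightarrow> q = f"
    using predicate_Zorn[of A P] by blast
  have sub: "sublinear f" using f by (simp add: A_def)
  have super: "f y + f a \<le> f (y + a)" for y a
  proof -
    have le: "lower_along f a z \<le> f z" for z
      using lower_along_le[OF sub, of 0 a z] by simp
    moreover have "f z \<le> p z" for z
      using f by (simp add: A_def)
    ultimately have "lower_along f a \<in> A"
      using sublinear_lower_along[OF sub, of a] order_trans unfolding A_def by blast
    moreover have "P f (lower_along f a)"
      using le by (simp add: P_def)
    ultimately have "lower_along f a = f" by (rule min)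
    with lower_along_le[OF sub, of 1 a y] show ?thesis by simp
  qed
  have add: "f (x + y) = f x + f y" for x y
    using super[of x y] sub by (auto simp: sublinear_def intro: antisym)
  have neg: "f (- x) = - f x" for x
    using add[of x "- x"] sublinear_zero[OF sub] by simp
  have "f (t *\<^sub>R x) = t * f x" for t x
  proof (cases "0 \<le> t")
    case True with sub show ?thesis by (simp add: sublinear_def)
  next
    case False
    then have "f ((- t) *\<^sub>R x) = (- t) * f x"
      using sub unfolding sublinear_def by (meson linear neg_0_le_iff_le)
    with neg[of "t *\<^sub>R x"] show ?thesis by simp
  qed
  then have "linear f" by (intro linearI) (auto simp: add)
  with f show ?thesis by (auto simp: A_def)
qed

text \<open>Lowering the norm along \<open>x\<close> before minimising gives the value \<open>- norm x\<close> at \<open>- x\<close>, and this forces a linear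
functional below it to attain \<open>norm x\<close> at \<open>x\<close>.\<close>

lemma norming_functional:
  fixes x :: "'a::real_normed_vector"
  shows "\<exists>f. linear f \<and> (\<forall>y. \<bar>f y\<bar> \<le> norm y) \<and> f x = norm x"
proof -
  have "sublinear (norm :: 'a \<Rightarrow> real)" by (auto simp: sublinear_def norm_triangle_ineq)
  note sub = sublinear_lower_along[OF this, of x] and le = lower_along_le[OF this, of _ x]
  from sublinear_imp_linear_below[OF sub] obtain f
    where f: "linear f" and below: "\<And>y. f y \<le> lower_along norm x y" by blast
  have le_norm: "f y \<le> norm y" for y
    using below[of y] le[of 0 y] by simp
  have "\<bar>f y\<bar> \<le> norm y" for y
    using le_norm[of y] le_norm[of "- y"] linear_neg[OF f, of y] by auto
  moreover have "norm x \<le> f x"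
    using below[of "- x"] le[of 1 "- x"] linear_neg[OF f, of x] by simp
  ultimately show ?thesis using f le_norm[of x] by (intro exI[of _ f]) auto
qed

section \<open>Cardinal bounds and greedy selection\<close>

lemma card_le_iff_inj:
  "Card_order r \<Longrightarrow> |A| \<le>o r \<longleftrightarrow> (\<exists>e. inj_on e A \<and> e ` A \<subseteq> Field r)"
  unfolding card_of_ordLeq
  using card_of_Field_ordIso[of r] ordLeq_ordIso_trans ordIso_symmetric by blast

lemma card_le_subset: "A \<subseteq> B \<Longrightarrow> |B| \<le>o r \<Longrightarrow> |A| \<le>o r"
  using card_of_mono1 ordLeq_transitive by blast

lemma card_le_finite: "Cinfinite r \<Longrightarrow> finite A \<Longrightarrow> |A| \<le>o r"
  by (metis Cfinite_ordLess_Cinfinite Field_card_of card_of_Card_order cfinite_def ordLess_imp_ordLeq)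

lemma card_le_insert: "Cinfinite r \<Longrightarrow> |A| \<le>o r \<Longrightarrow> |insert x A| \<le>o r"
  using card_of_Un_ordLeq_infinite_Field[of r "{x}" A] card_le_finite[of r "{x}"]
  by (simp add: cinfinite_def)

text \<open>All upper bounds of the form \<open>2 ^ r\<close> below are obtained by coding elements as subsets of a set of
cardinality at most \<open>r\<close>.\<close>

lemma card_le_two_power:
  assumes r: "Cinfinite r" and "inj_on F A" "F ` A \<subseteq> Pow B" "|B| \<le>o r"
  shows "|A| \<le>o ctwo ^c r"
proof -
  obtain e where e: "inj_on e B" "e ` B \<subseteq> Field r"
    using assms card_le_iff_inj by blast
  have "inj_on (\<lambda>x. e ` F x) A"
  proof (rule inj_onI)
    fix x y assume xy: "x \<in> A" "y \<in> A" "e ` F x = e ` F y"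
    then have "F x = F y" using assms(3) inj_on_image_eq_iff[OF e(1), of "F x" "F y"] by blast
    then show "x = y" using assms(2) xy by (simp add: inj_on_eq_iff)
  qed
  moreover have "(\<lambda>x. e ` F x) ` A \<subseteq> Pow (Field r)"
    using assms(3) e(2) by blast
  ultimately have "|A| \<le>o |Pow (Field r)|"
    using card_of_ordLeq by blast
  also have "|Pow (Field r)| =o |Func (Field r) (UNIV :: bool set)|"
    by (rule card_of_Pow_Func)
  also have "|Func (Field r) (UNIV :: bool set)| = ctwo ^c r"
    by (simp add: cexp_def ctwo_def Field_card_of)
  finally show ?thesis .
qed

lemma subset_of_card_order:
  fixes E :: "'e set" and r :: "'r rel"
  assumes "Card_order r" "r \<le>o |E|"
  shows "\<exists>E'\<subseteq>E. |E'| =o r"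
proof -
  have F: "|Field r| =o r" using assms(1) by (rule card_of_Field_ordIso)
  then obtain e where "inj_on e (Field r)" "e ` Field r \<subseteq> E"
    using assms(2) card_of_ordLeq[of "Field r" E] ordIso_ordLeq_trans by blast
  then have "|e ` Field r| =o |Field r|"
    by (meson bij_betw_imageI card_of_ordIso ordIso_symmetric)
  with F have "|e ` Field r| =o r" using ordIso_transitive by blast
  with \<open>e ` Field r \<subseteq> E\<close> show ?thesis by blast
qed

lemma exists_wellorder: "\<exists>le lt. class.wellorder (le :: 'a \<Rightarrow> 'a \<Rightarrow> bool) lt"
proof -
  obtain r :: "'a rel" where r: "Well_order r" "Field r = UNIV"
    using well_ordering[where 'a = 'a] by (elim exE conjE)
  define le where "le x y \<longleftrightarrow> (x, y) \<in> r" for x y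
  define lt where "lt x y \<longleftrightarrow> (x, y) \<in> r - Id" for x y
  have refl: "(x, x) \<in> r" for x
    using r unfolding order_on_defs refl_on_def by auto
  have total: "(x, y) \<in> r \<or> (y, x) \<in> r" for x y
    using r refl by (cases "x = y") (auto simp: order_on_defs total_on_def)
  have trans: "trans r" and antisym: "antisym r" and wf: "wf (r - Id)"
    using r unfolding order_on_defs by blast+
  have "class.wellorder le lt"
  proof
    show "lt x y \<longleftrightarrow> le x y \<and> \<not> le y x" for x y
      using refl antisymD[OF antisym, of x y] unfolding le_def lt_def by blast
    show "le x x" "le x y \<or> le y x" for x y
      using refl total unfolding le_def by blast+
    show "le x z" if "le x y" "le y z" for x y z
      using that transD[OF trans] unfolding le_def by blast
    show "x = y" if "le x y" "le y x" for x y
      using that antisymD[OF antisym] unfolding le_def by blast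
    show "P a" if "\<And>x. (\<And>y. lt y x \<Longrightarrow> P y) \<Longrightarrow> P x" for P a
      using wf by (induction a rule: wf_induct_rule) (rule that, simp add: lt_def)
  qed
  then show ?thesis by blast
qed

context wellorder
begin

text \<open>Greedy selection along a well-order: whether \<open>y\<close> is chosen may depend on the elements already chosen
below \<open>y\<close>. It serves in place of transfinite sequences: the chosen elements index
themselves, so no ordinals are needed.\<close>

lemma greedy_set:
  "\<exists>G. \<forall>y. y \<in> G \<longleftrightarrow> Q (G \<inter> {..<y}) y"
proof -
  define F where "F g y = Q {z. z < y \<and> g z} y" for g y
  define g where "g = wfrec {(x, y). x < y} F"
  have "g y \<longleftrightarrow> Q {z. z < y \<and> g z} y" for y
  proof -
    have "g y = F (cut g {(x, y). x < y} y) y"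
      unfolding g_def by (rule wfrec[OF wf])
    moreover have "{z. z < y \<and> cut g {(x, y). x < y} y z} = {z. z < y \<and> g z}"
      by (auto simp: cut_def)
    ultimately show ?thesis by (simp add: F_def)
  qed
  moreover have "{z. z < y \<and> g z} = Collect g \<inter> {..<y}" for y by auto
  ultimately have "y \<in> Collect g \<longleftrightarrow> Q (Collect g \<inter> {..<y}) y" for y
    by auto
  then show ?thesis by blast
qed

section \<open>The Erdos--Rado theorem for triples\<close>

text \<open>The inductive step of the Erdos--Rado theorem: on a set of more than \<open>2 ^ r\<close> points, one can make a
colouring by \<open>r\<close> colours independent of its last argument on a subset of more than \<open>r\<close> points.

For each point \<open>x\<close> collect greedily those \<open>y \<le> x\<close> which the colours with respect to the points collected so
far do not distinguish from \<open>x\<close>. On this set \<open>G x\<close> the last argument is irrelevant by construction. If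
all sets \<open>G x\<close> had at most \<open>r\<close> elements, then the isomorphism type of \<open>G x\<close>, as a well-ordered set coloured
by \<open>\<lambda>l j. c l j x\<close>, could be coded by a subset of \<open>r \<times> r \<times> colours\<close>. This code determines \<open>x\<close>: an
isomorphism from \<open>G x\<close> to \<open>G y\<close> is the identity, because at the first point that it moved, the smaller
of this point and its image would have been collected on the other side as well.

The case \<open>l = j\<close> is included so that the lemma applies to colourings of pairs too.\<close>

lemma end_homogeneous_subset:
  fixes c :: "'a \<Rightarrow> 'a \<Rightarrow> 'a \<Rightarrow> 'col" and r :: "'r rel"
  assumes r: "Cinfinite r" and col: "|UNIV :: 'col set| \<le>o r"
    and big: "\<not> |L| \<le>o ctwo ^c r"
  shows "\<exists>H\<subseteq>L. \<not> |H| \<le>o r \<and>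
    (\<forall>l\<in>H. \<forall>j\<in>H. \<forall>x\<in>H. \<forall>y\<in>H. l \<le> j \<and> j < x \<and> j < y \<longrightarrow> c l j x = c l j y)"
proof -
  have "\<exists>G. \<forall>y. y \<in> G \<longleftrightarrow>
      y \<in> L \<and> y \<le> x \<and> (\<forall>l\<in>G \<inter> {..<y}. \<forall>j\<in>G \<inter> {..<y}. l \<le> j \<longrightarrow> c l j y = c l j x)" for x
    by (rule greedy_set)
  then obtain G where G: "y \<in> G x \<longleftrightarrow> y \<in> L \<and> y \<le> x \<and>
      (\<forall>l\<in>G x \<inter> {..<y}. \<forall>j\<in>G x \<inter> {..<y}. l \<le> j \<longrightarrow> c l j y = c l j x)" for x y
    by metis
  have top: "x \<in> G x" if "x \<in> L" for x
    using that by (subst G) auto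
  have "\<exists>x\<in>L. \<not> |G x| \<le>o r"
  proof (rule ccontr)
    assume "\<not> ?thesis"
    then have "\<forall>x\<in>L. \<exists>e. inj_on e (G x) \<and> e ` G x \<subseteq> Field r"
      using r card_le_iff_inj by blast
    then obtain e where inj: "\<And>x. x \<in> L \<Longrightarrow> inj_on (e x) (G x)"
        and range: "\<And>x. x \<in> L \<Longrightarrow> e x ` G x \<subseteq> Field r"
      by metis
    define code where "code x = {(e x l, e x j, c l j x) |l j. l \<in> G x \<and> j \<in> G x \<and> l \<le> j}" for x
    have "x = y" if x: "x \<in> L" and y: "y \<in> L" and eq: "code x = code y" for x y
    proof -
      have "e x ` G x = {a. \<exists>d. (a, a, d) \<in> code x}" if "x \<in> L" for x
        using inj_onD[OF inj[OF that]] unfolding code_def by blast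
      from this[OF x] this[OF y] eq have im: "e x ` G x = e y ` G y" by simp
      \<comment> \<open>The isomorphism \<open>\<phi>\<close> from \<open>G x\<close> to \<open>G y\<close> induced by the equality of the codes.\<close>
      define \<phi> where "\<phi> z = the_inv_into (G y) (e y) (e x z)" for z
      have \<phi>_in: "\<phi> z \<in> G y" and e\<phi>: "e y (\<phi> z) = e x z" if "z \<in> G x" for z
      proof -
        have "e x z \<in> e y ` G y" unfolding im[symmetric] using that by simp
        then show "\<phi> z \<in> G y" "e y (\<phi> z) = e x z"
          using inj[OF y] unfolding \<phi>_def by (simp_all add: the_inv_into_into f_the_inv_into_f)
      qed
      have \<phi>_onto: "w \<in> \<phi> ` G x" if "w \<in> G y" for w
      proof -
        have "e y w \<in> e x ` G x" unfolding im using that by simp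
        then obtain z where "z \<in> G x" "e y w = e x z" by (rule imageE)
        then have "w = \<phi> z" using e\<phi>[of z] \<phi>_in[of z] inj_onD[OF inj[OF y]] that by simp
        then show ?thesis using \<open>z \<in> G x\<close> by blast
      qed
      have \<phi>_le: "\<phi> l \<le> \<phi> j \<and> c l j x = c (\<phi> l) (\<phi> j) y"
        if "l \<in> G x" "j \<in> G x" "l \<le> j" for l j
      proof -
        have "(e x l, e x j, c l j x) \<in> code y"
          using that eq[symmetric] by (auto simp: code_def)
        then obtain l' j' where "l' \<in> G y" "j' \<in> G y" "l' \<le> j'"
            "e x l = e y l'" "e x j = e y j'" "c l j x = c l' j' y"
          by (auto simp: code_def)
        moreover from this have "l' = \<phi> l" "j' = \<phi> j"
          using inj_onD[OF inj[OF y]] \<phi>_in e\<phi> that by simp_all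
        ultimately show ?thesis by simp
      qed
      have \<phi>_inj: "z = w" if "z \<in> G x" "w \<in> G x" "\<phi> z = \<phi> w" for z w
        using that e\<phi>[of z] e\<phi>[of w] inj_onD[OF inj[OF x], of z w] by simp
      have \<phi>_less: "\<phi> z < \<phi> w" if "z \<in> G x" "w \<in> G x" "z < w" for z w
        using that \<phi>_le[of z w] \<phi>_inj[of z w] by (auto simp: less_le)
      have id: "\<phi> z = z" if "z \<in> G x" for z
        using that
      proof (induction z rule: less_induct)
        case (less z)
        \<comment> \<open>Up to \<open>z\<close> the map is the identity, so \<open>z\<close> and its image were tested against the same set of points.\<close>
        have below: "G y \<inter> {..<\<phi> z} = G x \<inter> {..<z}"
        proof (intro equalityI subsetI)
          fix w assume w: "w \<in> G y \<inter> {..<\<phi> z}"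
          then obtain v where v: "v \<in> G x" "w = \<phi> v" using \<phi>_onto by blast
          then have "v < z" using w \<phi>_le[of z v] less.prems by (auto simp: not_le[symmetric])
          with v less.IH show "w \<in> G x \<inter> {..<z}" by auto
        next
          fix w assume "w \<in> G x \<inter> {..<z}"
          with less.IH[of w] \<phi>_in[of w] \<phi>_less[of w z] less.prems show "w \<in> G y \<inter> {..<\<phi> z}" by auto
        qed
        have same: "c l j x = c l j y" if "l \<in> G x \<inter> {..<z}" "j \<in> G x \<inter> {..<z}" "l \<le> j" for l j
          using \<phi>_le[of l j] less.IH[of l] less.IH[of j] that by auto
        have zL: "z \<in> L" "z \<le> x" "\<phi> z \<in> L" "\<phi> z \<le> y"
          using G less.prems \<phi>_in[OF less.prems] by blast+
        have cz: "c l j z = c l j x" if "l \<in> G x \<inter> {..<z}" "j \<in> G x \<inter> {..<z}" "l \<le> j" for l j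
          using G[of z x] less.prems that by blast
        have c\<phi>: "c l j (\<phi> z) = c l j y" if "l \<in> G x \<inter> {..<z}" "j \<in> G x \<inter> {..<z}" "l \<le> j" for l j
          using G[of "\<phi> z" y] \<phi>_in[OF less.prems] that unfolding below by blast
        show ?case
        proof (rule linorder_cases[of "\<phi> z" z])
          assume lt: "\<phi> z < z"
          have "G x \<inter> {..<\<phi> z} = G x \<inter> {..<z}"
            using eqset_imp_iff[OF below] less_trans[OF _ lt] by auto
          then have "\<phi> z \<in> G x"
            using zL lt c\<phi> same by (subst G) auto
          with lt eqset_imp_iff[OF below, of "\<phi> z"] show ?thesis by simp
        next
          assume lt: "z < \<phi> z"
          have "G y \<inter> {..<z} = G x \<inter> {..<z}"
            using eqset_imp_iff[OF below] less_trans[OF _ lt] by auto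
          then have "z \<in> G y"
            using zL lt cz same by (subst G) auto
          with lt eqset_imp_iff[OF below, of z] show ?thesis by simp
        qed
      qed
      have "x \<in> G y" "y \<in> G x"
        using \<phi>_in[OF top[OF x]] id[OF top[OF x]] \<phi>_onto[OF top[OF y]] id by auto
      then show "x = y" using G[of x y] G[of y x] by (auto intro: order.antisym)
    qed
    then have "inj_on code L" by (auto intro: inj_onI)
    moreover have "code ` L \<subseteq> Pow (Field r \<times> Field r \<times> UNIV)"
      using range unfolding code_def by fastforce
    moreover have "|Field r \<times> Field r \<times> (UNIV :: 'col set)| \<le>o r"
      using r col
      by (intro card_of_Times_ordLeq_infinite_Field)
        (auto simp: cinfinite_def ordIso_imp_ordLeq card_of_Field_ordIso)
    ultimately show False using card_le_two_power[OF r] big by blast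
  qed
  then obtain x where x: "x \<in> L" and Gx: "\<not> |G x| \<le>o r" by blast
  define H where "H = G x - {x}"
  have HL: "H \<subseteq> L" using iffD1[OF G[of _ x]] unfolding H_def by blast
  have Hr: "\<not> |H| \<le>o r"
  proof
    assume "|H| \<le>o r"
    moreover have "G x \<subseteq> H \<union> {x}" by (auto simp: H_def)
    ultimately have "|G x| \<le>o r"
      using card_le_subset card_le_insert[OF r] by (metis Un_insert_right sup_bot_right)
    with Gx show False ..
  qed
  have top_colour: "c l j u = c l j x"
    if "l \<in> H" "j \<in> H" "u \<in> H" "l \<le> j" "j < u" for l j u
    using iffD1[OF G[of u x]] that unfolding H_def by (auto intro: le_less_trans)
  show ?thesis
  proof (intro exI[of _ H] conjI HL Hr ballI impI)
    fix l j u v assume "l \<in> H" "j \<in> H" "u \<in> H" "v \<in> H" "l \<le> j \<and> j < u \<and> j < v"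
    then show "c l j u = c l j v"
      using top_colour[of l j u] top_colour[of l j v] by simp
  qed
qed

text \<open>The Erdos--Rado theorem for triples, \<open>(2 ^ (2 ^ r))\<^sup>+ \<rightarrow> (r\<^sup>+)\<close> with exponent three and \<open>r\<close> colours. Removing the
dependence on the last argument costs one exponential each time; after two removals the colour
depends on the first argument only, and one of the at most \<open>r\<close> colour classes has more than \<open>r\<close> elements.
Throughout, \<open>\<not> |A| \<le>o r\<close> expresses that \<open>A\<close> has more than \<open>r\<close> elements.\<close>

theorem Erdos_Rado_triples:
  fixes c :: "'a \<Rightarrow> 'a \<Rightarrow> 'a \<Rightarrow> 'col" and r :: "'r rel"
  assumes r: "Cinfinite r" and col: "|UNIV :: 'col set| \<le>o r"
    and big: "\<not> |L| \<le>o ctwo ^c (ctwo ^c r)"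
  shows "\<exists>G\<subseteq>L. \<not> |G| \<le>o r \<and>
    (\<exists>d. \<forall>l\<in>G. \<forall>j\<in>G. \<forall>x\<in>G. l < j \<and> j < x \<longrightarrow> c l j x = d)"
proof -
  have le: "r \<le>o ctwo ^c r"
    using r by (intro ordLess_imp_ordLeq ordLess_ctwo_cexp) simp
  have r2: "Cinfinite (ctwo ^c r)"
    using r by (intro Cinfinite_cexp) (simp_all add: ordLeq_refl Card_order_ctwo)
  obtain H where H: "H \<subseteq> L" "\<not> |H| \<le>o ctwo ^c r"
    and indep: "\<And>l j x y. \<lbrakk>l \<in> H; j \<in> H; x \<in> H; y \<in> H; l \<le> j; j < x; j < y\<rbrakk> \<Longrightarrow> c l j x = c l j y"
    using end_homogeneous_subset[OF r2 ordLeq_transitive[OF col le] big, of c] by blast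
  define c2 where "c2 l j = c l j (SOME x. x \<in> H \<and> j < x)" for l j
  have c2: "c l j x = c2 l j" if "l \<in> H" "j \<in> H" "x \<in> H" "l \<le> j" "j < x" for l j x
    using that someI[of "\<lambda>x. x \<in> H \<and> j < x" x] unfolding c2_def
    by (intro indep) simp_all
  \<comment> \<open>The same lemma again, now for the colouring of pairs by \<open>c2\<close>.\<close>
  obtain H' where H': "H' \<subseteq> H" "\<not> |H'| \<le>o r"
    and indep': "\<And>l x y. \<lbrakk>l \<in> H'; x \<in> H'; y \<in> H'; l < x; l < y\<rbrakk> \<Longrightarrow> c2 l x = c2 l y"
    using end_homogeneous_subset[OF r col H(2), of "\<lambda>l j x. c2 l x"] by blast
  define c1 where "c1 l = c2 l (SOME x. x \<in> H' \<and> l < x)" for l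
  have c1: "c2 l j = c1 l" if "l \<in> H'" "j \<in> H'" "l < j" for l j
    using that someI[of "\<lambda>x. x \<in> H' \<and> l < x" j] unfolding c1_def
    by (intro indep') simp_all
  have "\<exists>d. \<not> |{l \<in> H'. c1 l = d}| \<le>o r"
  proof (rule ccontr)
    assume "\<not> ?thesis"
    then have "|\<Union>d. {l \<in> H'. c1 l = d}| \<le>o r"
      using r col by (intro card_of_UNION_ordLeq_infinite_Field) (auto simp: cinfinite_def)
    moreover have "(\<Union>d. {l \<in> H'. c1 l = d}) = H'" by auto
    ultimately show False using H'(2) by simp
  qed
  then obtain d where d: "\<not> |{l \<in> H'. c1 l = d}| \<le>o r" by blast
  show ?thesis
  proof (intro exI[of _ "{l \<in> H'. c1 l = d}"] conjI d exI[of _ d] ballI impI)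
    show "{l \<in> H'. c1 l = d} \<subseteq> L" using H'(1) H(1) by blast
    fix l j x
    assume "l \<in> {l \<in> H'. c1 l = d}" "j \<in> {l \<in> H'. c1 l = d}" "x \<in> {l \<in> H'. c1 l = d}"
      "l < j \<and> j < x"
    then show "c l j x = d"
      using c2[of l j x] c1[of l j] H'(1) by (auto simp: less_imp_le)
  qed
qed

text \<open>Cutting a large well-ordered set into consecutive pairs. Let \<open>s i\<close> be the successor of \<open>i\<close> in \<open>G\<close>, and
choose \<open>i\<close> as a left end exactly if it is not the successor of a left end. Every element of \<open>G\<close> except
possibly the last one is then a left end or the successor of one; as \<open>r\<close> is infinite, \<open>r\<close> left ends
could not account for more than \<open>r\<close> elements of \<open>G\<close>.\<close>

lemma disjoint_successor_pairs:
  fixes r :: "'r rel"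
  assumes r: "Cinfinite r" and big: "\<not> |G| \<le>o r"
  shows "\<exists>E\<subseteq>G. \<exists>s. \<not> |E| \<le>o r \<and> (\<forall>i\<in>E. s i \<in> G \<and> i < s i) \<and> (\<forall>i\<in>E. \<forall>j\<in>E. i < j \<longrightarrow> s i < j)"
proof -
  define s where "s i = (LEAST j. j \<in> G \<and> i < j)" for i
  have s: "s i \<in> G \<and> i < s i" "s i \<le> j" if "j \<in> G" "i < j" for i j
    using LeastI[of "\<lambda>j. j \<in> G \<and> i < j" j] Least_le[of "\<lambda>j. j \<in> G \<and> i < j" j] that
    by (simp_all add: s_def)
  obtain E where E: "y \<in> E \<longleftrightarrow> y \<in> G \<and> (\<exists>j\<in>G. y < j) \<and> (\<forall>i\<in>E \<inter> {..<y}. s i \<noteq> y)" for y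
    using greedy_set[of "\<lambda>B y. y \<in> G \<and> (\<exists>j\<in>G. y < j) \<and> (\<forall>i\<in>B. s i \<noteq> y)"] by blast
  have EG: "i \<in> G" "s i \<in> G" "i < s i" if "i \<in> E" for i
    using iffD1[OF E[of i] that] s by blast+
  have "\<not> |E| \<le>o r"
  proof
    assume "|E| \<le>o r"
    then have "|s ` E| \<le>o r"
      using card_of_image ordLeq_transitive by blast
    \<comment> \<open>Only a largest element of \<open>G\<close> has no successor, so there is at most one such element.\<close>
    moreover have "y = (THE y. y \<in> G \<and> (\<forall>j\<in>G. j \<le> y))" if "y \<in> G" "\<forall>j\<in>G. j \<le> y" for y
      using that by (intro the_equality[symmetric]) (auto intro: order.antisym)
    then have "{y \<in> G. \<forall>j\<in>G. j \<le> y} \<subseteq> {THE y. y \<in> G \<and> (\<forall>j\<in>G. j \<le> y)}"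
      by blast
    then have "|{y \<in> G. \<forall>j\<in>G. j \<le> y}| \<le>o r"
      using card_le_finite[OF r] finite_subset by blast
    ultimately have "|(E \<union> s ` E) \<union> {y \<in> G. \<forall>j\<in>G. j \<le> y}| \<le>o r"
      using r \<open>|E| \<le>o r\<close> by (intro card_of_Un_ordLeq_infinite_Field) (auto simp: cinfinite_def)
    moreover have "G \<subseteq> (E \<union> s ` E) \<union> {y \<in> G. \<forall>j\<in>G. j \<le> y}"
      using iffD2[OF E] by (force simp: not_le)
    ultimately show False using big card_le_subset by blast
  qed
  moreover have "s i < j" if "i \<in> E" "j \<in> E" "i < j" for i j
    using s(2)[of j i] EG[of i] EG[of j] iffD1[OF E[of j]] that by (auto simp: less_le)
  ultimately show ?thesis
    using EG by (intro exI[of _ E] exI[of _ s] conjI) auto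
qed

end

section \<open>Spans and the dual unit ball\<close>

context normed_scaling
begin

text \<open>As the scalar field has at most \<open>r\<close> elements, passing to the whole linear span, not merely to rational
combinations, does not increase the cardinality beyond \<open>r\<close>.\<close>

lemma card_span_le:
  fixes r :: "'r rel"
  assumes r: "Cinfinite r" and K: "|UNIV :: 'k set| \<le>o r" and A: "|A| \<le>o r"
  shows "|span A| \<le>o r"
proof -
  define T where "T = rec_nat {0} (\<lambda>_ B. (\<lambda>(u, c, a). u + sc c a) ` (B \<times> UNIV \<times> A))"
  have T0: "T 0 = {0}" and TS: "T (Suc n) = (\<lambda>(u, c, a). u + sc c a) ` (T n \<times> UNIV \<times> A)" for n
    by (simp_all add: T_def)
  have Tn: "|T n| \<le>o r" for n
  proof (induction n)
    case 0 then show ?case by (simp add: T0 card_le_finite[OF r])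
  next
    case (Suc n)
    have "|T n \<times> (UNIV :: 'k set) \<times> A| \<le>o r"
      using Suc K A r by (intro card_of_Times_ordLeq_infinite_Field) (auto simp: cinfinite_def)
    then show ?case unfolding TS using card_of_image ordLeq_transitive by blast
  qed
  have "|UNIV :: nat set| \<le>o r"
    using r infinite_iff_card_of_nat[of "Field r"] card_of_Field_ordIso[of r] ordLeq_ordIso_trans
    unfolding cinfinite_def by blast
  then have "|\<Union>n. T n| \<le>o r"
    using r Tn by (intro card_of_UNION_ordLeq_infinite_Field) (auto simp: cinfinite_def)
  moreover have "span A \<subseteq> (\<Union>n. T n)"
  proof
    fix u assume "u \<in> span A"
    then show "u \<in> (\<Union>n. T n)"
    proof (induction rule: span_induct_alt)
      case base then show ?case using T0 by (intro UN_I[of 0]) auto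
    next
      case (step c a u)
      then obtain n where "u \<in> T n" by blast
      with step(1) have "sc c a + u \<in> T (Suc n)"
        unfolding TS by (intro image_eqI[of _ _ "(u, c, a)"]) (auto simp: add.commute)
      then show ?case by blast
    qed
  qed
  ultimately show ?thesis by (rule card_le_subset[rotated])
qed

lemma subspace_closure:
  assumes "subspace S"
  shows "subspace (closure S)"
proof (rule subspaceI)
  show "0 \<in> closure S" using subspace_0[OF assms] closure_subset by blast
next
  fix x y assume "x \<in> closure S" "y \<in> closure S"
  then obtain f g where "\<forall>n. f n \<in> S" "f \<longlonglongrightarrow> x" "\<forall>n. g n \<in> S" "g \<longlonglongrightarrow> y"
    unfolding closure_sequential by blast
  then show "x + y \<in> closure S"
    unfolding closure_sequential using subspace_add[OF assms]
    by (intro exI[of _ "\<lambda>n. f n + g n"]) (auto intro: tendsto_add)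
next
  fix c :: 'k and x assume "x \<in> closure S"
  then obtain f where f: "\<forall>n. f n \<in> S" "f \<longlonglongrightarrow> x"
    unfolding closure_sequential by blast
  have "(\<lambda>n. norm c * norm (f n - x)) \<longlonglongrightarrow> 0"
    using f(2) by (intro tendsto_mult_right_zero) (simp add: tendsto_norm_zero LIM_zero)
  then have "(\<lambda>n. norm (sc c (f n) - sc c x)) \<longlonglongrightarrow> 0"
    by (simp add: norm_sc flip: scale_right_diff_distrib)
  then have "(\<lambda>n. sc c (f n)) \<longlonglongrightarrow> sc c x"
    by (rule LIM_zero_cancel[OF tendsto_norm_zero_cancel])
  with f(1) show "sc c x \<in> closure S"
    unfolding closure_sequential using subspace_scale[OF assms]
    by (intro exI[of _ "\<lambda>n. sc c (f n)"]) auto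
qed

text \<open>The closed unit ball of the dual of the whole space. Its elements are genuine functionals on the
ambient type, in contrast to the zero-extended functionals of \<^const>\<open>dual_space\<close>.\<close>

definition dual_ball :: "('a \<Rightarrow> 'k) set" where
  "dual_ball = {f. (\<forall>u v. f (u + v) = f u + f v) \<and> (\<forall>c u. f (sc c u) = c * f u) \<and>
                   (\<forall>u. norm (f u) \<le> norm u)}"

lemma dual_ballD:
  assumes "f \<in> dual_ball"
  shows dual_ball_add: "f (u + v) = f u + f v" and dual_ball_sc: "f (sc c u) = c * f u"
    and dual_ball_norm: "norm (f u) \<le> norm u" and dual_ball_0: "f 0 = 0"
    and dual_ball_diff: "f (u - v) = f u - f v"
proof -
  show add: "f (u + v) = f u + f v" for u v using assms by (simp add: dual_ball_def)
  show "f (sc c u) = c * f u" "norm (f u) \<le> norm u" using assms by (simp_all add: dual_ball_def)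
  show "f 0 = 0" using add[of 0 0] by simp
  show "f (u - v) = f u - f v" using add[of "u - v" v] by (simp add: algebra_simps)
qed

lemma dual_ball_tendsto:
  assumes "f \<in> dual_ball" "u \<longlonglongrightarrow> x"
  shows "(\<lambda>n. f (u n)) \<longlonglongrightarrow> f x"
proof (rule LIM_zero_cancel, rule tendsto_norm_zero_cancel)
  have "(\<lambda>n. norm (u n - x)) \<longlonglongrightarrow> 0"
    using assms(2) by (simp add: LIM_zero tendsto_norm_zero)
  moreover have "\<forall>n. norm (norm (f (u n) - f x)) \<le> norm (u n - x)"
    by (simp add: dual_ball_norm[OF assms(1)] dual_ball_diff[OF assms(1), symmetric])
  ultimately show "(\<lambda>n. norm (f (u n) - f x)) \<longlonglongrightarrow> 0"
    by (rule Lim_null_comparison[OF always_eventually, rotated])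
qed

lemma dual_ball_vanish_span:
  assumes "f \<in> dual_ball" "\<And>a. a \<in> A \<Longrightarrow> f a = 0" "u \<in> span A"
  shows "f u = 0"
  using assms(3)
proof (induction rule: span_induct_alt)
  case base show ?case by (rule dual_ball_0[OF assms(1)])
next
  case (step c a u)
  then show ?case
    by (simp only: dual_ball_add[OF assms(1)] dual_ball_sc[OF assms(1)] assms(2)) simp
qed

end

text \<open>The usual complexification \<open>f u = g u - \<i> g (\<i> u)\<close> of a real norming functional \<open>g\<close>. A rotation that makes
\<open>f u\<close> real turns \<open>\<bar>f u\<bar>\<close> into a value of \<open>g\<close>; and \<open>f x\<close> is real because its real part already exhausts
the bound \<open>norm x\<close>.\<close>

lemma norming_functional_complex:
  fixes sc :: "complex \<Rightarrow> 'a::real_normed_vector \<Rightarrow> 'a"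
  assumes "normed_scaling sc"
  shows "\<exists>f\<in>normed_scaling.dual_ball sc. f x = of_real (norm x)"
proof -
  interpret normed_scaling sc by (rule assms)
  obtain g where g: "linear g" and g_le: "\<And>u. \<bar>g u\<bar> \<le> norm u" and gx: "g x = norm x"
    using norming_functional[of x] by blast
  define f where "f u = Complex (g u) (- g (sc \<i> u))" for u
  have sc_eq: "sc c u = Re c *\<^sub>R u + Im c *\<^sub>R sc \<i> u" for c u
  proof -
    have "sc c u = sc (of_real (Re c) + of_real (Im c) * \<i>) u"
      using complex_eq[of c] by (simp add: mult.commute)
    also have "\<dots> = sc (of_real (Re c)) u + sc (of_real (Im c)) (sc \<i> u)"
      by (simp only: scale_left_distrib scale_scale)
    finally show ?thesis by (simp only: sc_of_real)
  qed
  have add: "f (u + v) = f u + f v" for u v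
    by (simp add: f_def complex_eq_iff scale_right_distrib linear_add[OF g])
  have mult: "f (sc c u) = c * f u" for c u
  proof -
    have 1: "g (sc c u) = Re c * g u + Im c * g (sc \<i> u)" for c
      by (subst sc_eq) (simp add: linear_add[OF g] linear_scale[OF g])
    show ?thesis
      using 1[of c] 1[of "\<i> * c"] by (simp add: f_def complex_eq_iff)
  qed
  have bound: "norm (f u) \<le> norm u" for u
  proof (cases "f u = 0")
    case False
    \<comment> \<open>The scalar that rotates \<open>f u\<close> onto the positive real axis.\<close>
    define c where "c = cnj (f u) / of_real (norm (f u))"
    have "norm c = 1" using False by (simp add: c_def norm_divide)
    have "f (sc c u) = of_real (norm (f u))"
      using False by (simp add: mult c_def complex_norm_square[symmetric] power2_eq_square field_simps)
    then have "norm (f u) = g (sc c u)"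
      by (simp add: f_def complex_eq_iff)
    also have "\<dots> \<le> norm (sc c u)" using g_le[of "sc c u"] by simp
    also have "\<dots> = norm u" using \<open>norm c = 1\<close> by (simp add: norm_sc)
    finally show ?thesis .
  qed simp
  have "f x = of_real (norm x)"
  proof -
    have "Re (f x) = norm x" by (simp add: f_def gx)
    moreover have "(Re (f x))\<^sup>2 + (Im (f x))\<^sup>2 \<le> (norm x)\<^sup>2"
      using bound[of x] by (metis cmod_power2 norm_ge_zero power_mono)
    ultimately show ?thesis by (simp add: complex_eq_iff)
  qed
  moreover have "f \<in> dual_ball" using add mult bound by (simp add: dual_ball_def)
  ultimately show ?thesis by blast
qed

lemma card_complex_le_real: "|UNIV :: complex set| \<le>o |UNIV :: real set|"
proof -
  have "inj (\<lambda>z. (Re z, Im z))" by (auto intro!: injI simp: complex_eq_iff)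
  then have "|UNIV :: complex set| \<le>o |(UNIV :: real set) \<times> (UNIV :: real set)|"
    using card_of_ordLeq by blast
  also have "|(UNIV :: real set) \<times> (UNIV :: real set)| =o |UNIV :: real set|"
    by (rule card_of_Times_same_infinite) (simp add: infinite_UNIV_char_0)
  finally show ?thesis .
qed

section \<open>Totality and weak-star density\<close>

lemma module_functions: "module (\<lambda>c (f :: 'b \<Rightarrow> 'k::comm_ring_1) y. c * f y)"
  by unfold_locales (auto simp: algebra_simps fun_eq_iff)

context normed_scaling
begin

abbreviation "fun_subspace \<equiv> module.subspace (\<lambda>c (f :: 'a \<Rightarrow> 'k) y. c * f y)"

lemma dual_space_eq_on_span:
  assumes h: "h \<in> dual_space sc Y" and g: "g \<in> dual_space sc Y" and Y: "subspace Y" and "A \<subseteq> Y"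
    and eq: "\<And>a. a \<in> A \<Longrightarrow> h a = g a" and "u \<in> span A"
  shows "h u = g u"
proof -
  have "u \<in> Y \<and> h u = g u"
    using assms(6)
  proof (induction rule: span_induct_alt)
    case base
    have zero: "f 0 = 0" if "f \<in> dual_space sc Y" for f
    proof -
      have "f (sc 0 0) = 0 * f 0" using that subspace_0[OF Y] unfolding dual_space_def by blast
      then show ?thesis by simp
    qed
    then show ?case using subspace_0[OF Y] zero[OF h] zero[OF g] by simp
  next
    case (step c a u)
    have a: "a \<in> Y" "sc c a \<in> Y" using step(1) assms(4) subspace_scale[OF Y] by auto
    have lin: "f (sc c a + u) = c * f a + f u" if "f \<in> dual_space sc Y" for f
      using that a step unfolding dual_space_def by auto
    then show ?case using subspace_add[OF Y] a step eq lin[OF h] lin[OF g] by simp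
  qed
  then show ?thesis ..
qed

text \<open>In a separating space of functionals, a vector on which every functional killing \<open>A\<close> vanishes is a
combination of \<open>A\<close>. In the induction step either no functional that kills \<open>A\<close> sees the new vector \<open>b\<close>,
and \<open>b\<close> can be dropped, or such a functional \<open>h0\<close> is used to subtract from \<open>a\<close> its \<open>b\<close>-component and from
each \<open>h\<close> its \<open>h0\<close>-component.\<close>

lemma dependent_of_common_kernel:
  assumes Y: "subspace Y" and F: "fun_subspace F" "F \<subseteq> dual_space sc Y"
    and total: "\<And>u. \<lbrakk>u \<in> Y; \<And>h. h \<in> F \<Longrightarrow> h u = 0\<rbrakk> \<Longrightarrow> u = 0"
    and "finite A" "A \<subseteq> Y" "a \<in> Y"
    and "\<And>h. \<lbrakk>h \<in> F; \<And>b. b \<in> A \<Longrightarrow> h b = 0\<rbrakk> \<Longrightarrow> h a = 0"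
  shows "a \<in> span A"
  using assms(5-)
proof (induction A arbitrary: a rule: finite_induct)
  case empty
  then show ?case using total[of a] by simp
next
  case (insert b A)
  interpret fm: module "\<lambda>c (f :: 'a \<Rightarrow> 'k) y. c * f y" by (rule module_functions)
  show ?case
  proof (cases "\<exists>h\<in>F. (\<forall>b'\<in>A. h b' = 0) \<and> h b \<noteq> 0")
    case False
    have "a \<in> span A"
    proof (rule insert.IH)
      fix h assume "h \<in> F" "\<And>b'. b' \<in> A \<Longrightarrow> h b' = 0"
      with False have "h b' = 0" if "b' \<in> insert b A" for b' using that by blast
      with \<open>h \<in> F\<close> show "h a = 0" by (rule insert.prems(3))
    qed (use insert.prems in auto)
    then show ?thesis using span_mono[of A "insert b A"] by blast
  next
    case True
    then obtain h0 where h0: "h0 \<in> F" "\<forall>b'\<in>A. h0 b' = 0" "h0 b \<noteq> 0" by blast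
    define t where "t = h0 a / h0 b"
    have Fd: "h (u - sc c v) = h u - c * h v" if "h \<in> F" "u \<in> Y" "v \<in> Y" for h u v c
    proof -
      have "h \<in> dual_space sc Y" "sc (- c) v \<in> Y" using that F(2) subspace_scale[OF Y] by blast+
      then have "h (u + sc (- c) v) = h u + h (sc (- c) v)" "h (sc (- c) v) = (- c) * h v"
        using that(2,3) unfolding dual_space_def by blast+
      then show ?thesis by simp
    qed
    have "a - sc t b \<in> span A"
    proof (rule insert.IH)
      show "A \<subseteq> Y" "a - sc t b \<in> Y"
        using insert.prems Y by (auto intro: subspace_diff subspace_scale)
      fix h assume h: "h \<in> F" "\<And>b'. b' \<in> A \<Longrightarrow> h b' = 0"
      define h' where "h' = h - (\<lambda>y. (h b / h0 b) * h0 y)"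
      have "h' \<in> F"
        unfolding h'_def by (intro fm.subspace_diff fm.subspace_scale F h h0)
      moreover have "h' b' = 0" if "b' \<in> insert b A" for b'
        using that h h0 by (auto simp: h'_def)
      ultimately have "h' a = 0" using insert.prems(3) by blast
      then show "h (a - sc t b) = 0"
        using insert.prems h by (simp add: Fd t_def h'_def field_simps)
    qed
    then show ?thesis unfolding span_breakdown_eq by blast
  qed
qed

text \<open>A new point \<open>a\<close> can be adjusted by a functional that kills \<open>A\<close> but not \<open>a\<close>; if there is none, then \<open>a\<close> is a
combination of \<open>A\<close> and nothing is left to adjust.\<close>

lemma total_interpolates:
  assumes Y: "subspace Y" and F: "fun_subspace F" "F \<subseteq> dual_space sc Y"
    and total: "\<And>u. \<lbrakk>u \<in> Y; \<And>h. h \<in> F \<Longrightarrow> h u = 0\<rbrakk> \<Longrightarrow> u = 0"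
    and g: "g \<in> dual_space sc Y" and "finite A" "A \<subseteq> Y"
  shows "\<exists>h\<in>F. \<forall>a\<in>A. h a = g a"
  using assms(6-)
proof (induction A rule: finite_induct)
  interpret fm: module "\<lambda>c (f :: 'a \<Rightarrow> 'k) y. c * f y" by (rule module_functions)
  {
    case empty
    then show ?case using fm.subspace_0[OF F(1)] by blast
  next
    case (insert a A)
    then obtain h where h: "h \<in> F" "\<forall>b\<in>A. h b = g b" by auto
    show ?case
    proof (cases "\<exists>h0\<in>F. (\<forall>b\<in>A. h0 b = 0) \<and> h0 a \<noteq> 0")
      case True
      then obtain h0 where h0: "h0 \<in> F" "\<forall>b\<in>A. h0 b = 0" "h0 a \<noteq> 0" by blast
      define h' where "h' = h + (\<lambda>y. ((g a - h a) / h0 a) * h0 y)"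
      have "h' \<in> F" unfolding h'_def by (intro fm.subspace_add fm.subspace_scale F h h0)
      moreover have "\<forall>b\<in>insert a A. h' b = g b" using h h0 by (auto simp: h'_def)
      ultimately show ?thesis by blast
    next
      case False
      then have a: "a \<in> span A"
        using insert dependent_of_common_kernel[OF Y F total, of A a] by blast
      have hY: "h \<in> dual_space sc Y" using h(1) F(2) by blast
      have "h a = g a"
      proof (rule dual_space_eq_on_span[OF hY g Y _ _ a])
        show "A \<subseteq> Y" using insert.prems by simp
      qed (use h(2) in blast)
      with h show ?thesis by auto
    qed
  }
qed

lemma fun_subspace_dual_space:
  assumes Y: "subspace Y"
  shows "fun_subspace (dual_space sc Y)"
proof -
  interpret fm: module "\<lambda>c (f :: 'a \<Rightarrow> 'k) y. c * f y" by (rule module_functions)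
  show ?thesis
  proof (rule fm.subspaceI)
    show "0 \<in> dual_space sc Y" by (auto simp: dual_space_def intro: exI[of _ 0])
  next
    fix f g assume f: "f \<in> dual_space sc Y" and g: "g \<in> dual_space sc Y"
    obtain B where B: "\<forall>x\<in>Y. norm (f x) \<le> B * norm x" using f unfolding dual_space_def by blast
    obtain C where C: "\<forall>x\<in>Y. norm (g x) \<le> C * norm x" using g unfolding dual_space_def by blast
    have "norm (f x + g x) \<le> (B + C) * norm x" if "x \<in> Y" for x
      using norm_triangle_ineq[of "f x" "g x"] bspec[OF B that] bspec[OF C that]
      by (simp add: distrib_right)
    then have "\<exists>B. \<forall>x\<in>Y. norm ((f + g) x) \<le> B * norm x" by auto
    then show "f + g \<in> dual_space sc Y"
      using f g unfolding dual_space_def by (auto simp: algebra_simps)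
  next
    fix c f assume f: "f \<in> dual_space sc Y"
    obtain B where B: "\<forall>x\<in>Y. norm (f x) \<le> B * norm x" using f unfolding dual_space_def by blast
    have "norm (c * f x) \<le> (norm c * B) * norm x" if "x \<in> Y" for x
      using mult_left_mono[OF bspec[OF B that], of "norm c"] by (simp add: norm_mult mult.assoc)
    then have "\<exists>B. \<forall>x\<in>Y. norm (c * f x) \<le> B * norm x" by auto
    then show "(\<lambda>y. c * f y) \<in> dual_space sc Y"
      using f unfolding dual_space_def by (auto simp: algebra_simps)
  qed
qed

text \<open>A basic neighbourhood in the weak-star topology restricts only finitely many values, and these can
even be attained exactly.\<close>

lemma weak_star_dense_if_total:
  assumes Y: "subspace Y" and F: "fun_subspace F" "F \<subseteq> dual_space sc Y"
    and total: "\<And>u. \<lbrakk>u \<in> Y; \<And>h. h \<in> F \<Longrightarrow> h u = 0\<rbrakk> \<Longrightarrow> u = 0"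
  shows "dual_space sc Y \<subseteq> weak_star sc Y closure_of F"
proof
  fix g assume g: "g \<in> dual_space sc Y"
  have finite_dependence: "\<exists>A. finite A \<and> A \<subseteq> Y \<and> (\<forall>h\<in>dual_space sc Y. (\<forall>a\<in>A. h a = g a) \<longrightarrow> h \<in> U)"
    if "generate_topology_on {{f \<in> dual_space sc Y. f y \<in> U} |y U. y \<in> Y \<and> open U} U" "g \<in> U" for U
    using that
  proof (induction rule: generate_topology_on.induct)
    case Empty
    then show ?case by simp
  next
    case (Int V W)
    from Int.IH Int.prems obtain A B where "finite A" "A \<subseteq> Y" "finite B" "B \<subseteq> Y"
      "\<forall>h\<in>dual_space sc Y. (\<forall>a\<in>A. h a = g a) \<longrightarrow> h \<in> V"
      "\<forall>h\<in>dual_space sc Y. (\<forall>a\<in>B. h a = g a) \<longrightarrow> h \<in> W" by blast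
    then show ?case by (intro exI[of _ "A \<union> B"]) auto
  next
    case (UN K)
    then obtain k where "k \<in> K" "g \<in> k" by blast
    with UN.IH[of k] obtain A where "finite A" "A \<subseteq> Y"
      "\<forall>h\<in>dual_space sc Y. (\<forall>a\<in>A. h a = g a) \<longrightarrow> h \<in> k" by blast
    with \<open>k \<in> K\<close> show ?case by (intro exI[of _ A]) auto
  next
    case (Basis V)
    then obtain y V' where "y \<in> Y" "V = {f \<in> dual_space sc Y. f y \<in> V'}" by blast
    with Basis.prems show ?case by (intro exI[of _ "{y}"]) auto
  qed
  have "topspace (weak_star sc Y) = dual_space sc Y"
    using subspace_0[OF Y] by (intro topspace_weak_star) blast
  moreover have "\<exists>h\<in>F. h \<in> U" if "g \<in> U" "openin (weak_star sc Y) U" for U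
  proof -
    have "generate_topology_on {{f \<in> dual_space sc Y. f y \<in> U} |y U. y \<in> Y \<and> open U} U"
      using that(2) by (simp only: weak_star_def openin_topology_generated_by_iff)
    from finite_dependence[OF this that(1)] obtain A where A: "finite A" "A \<subseteq> Y"
      "\<forall>h\<in>dual_space sc Y. (\<forall>a\<in>A. h a = g a) \<longrightarrow> h \<in> U" by blast
    obtain h where "h \<in> F" "\<forall>a\<in>A. h a = g a"
      using total_interpolates[OF Y F total g A(1,2)] by blast
    with A(3) F(2) show ?thesis by blast
  qed
  ultimately show "g \<in> weak_star sc Y closure_of F"
    using g by (auto simp: in_closure_of)
qed

end

locale banach_scaling = normed_scaling sc
  for sc :: "'k::real_normed_field \<Rightarrow> 'a::banach \<Rightarrow> 'a"
begin

text \<open>A long monotone basic sequence has total coordinate functionals. Well-founded induction on the initial segment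
\<open>S\<close> whose closed span contains \<open>x\<close>: choose vectors \<open>z n\<close> in the span of \<open>y ` S\<close> with limit \<open>x\<close>, fix one of them,
\<open>z m\<close>, close to \<open>x\<close>, and let \<open>k\<close> be the largest index that it uses. By monotonicity the parts \<open>p n\<close> of \<open>z n\<close>
with indices up to \<open>k\<close> form a Cauchy sequence. Its limit \<open>w\<close> is killed by all coordinate functionals.
As the \<open>k\<close>-th coordinate of \<open>p n\<close> tends to zero, \<open>w\<close> lies even in the closed span of the vectors before \<open>k\<close>
and vanishes by induction. Monotonicity, applied to \<open>p n - z m\<close>, then makes \<open>z m\<close> small, although \<open>z m\<close>
is close to \<open>x\<close>; so \<open>x\<close> cannot be different from zero.\<close>

lemma total_on_closed_span:
  fixes le less :: "'i \<Rightarrow> 'i \<Rightarrow> bool" and y :: "'i \<Rightarrow> 'a" and f :: "'i \<Rightarrow> 'a \<Rightarrow> 'k"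
  assumes wo: "class.wellorder le less"
    and f: "\<And>i. i \<in> E \<Longrightarrow> f i \<in> dual_ball"
    and biorth: "\<And>i j. \<lbrakk>i \<in> E; j \<in> E\<rbrakk> \<Longrightarrow> f i (y j) = (if i = j then 1 else 0)"
    and monotone: "\<And>k u v. \<lbrakk>k \<in> E; u \<in> span (y ` {i \<in> E. le i k}); v \<in> span (y ` {i \<in> E. less k i})\<rbrakk>
      \<Longrightarrow> norm u \<le> norm (u + v)"
    and x: "x \<in> closure (span (y ` E))" and zero: "\<And>i. i \<in> E \<Longrightarrow> f i x = 0"
  shows "x = 0"
proof -
  interpret wo: wellorder le less by (rule wo)
  define total where "total S \<longleftrightarrow>
    (\<forall>x\<in>closure (span (y ` S)). (\<forall>i\<in>E. f i x = 0) \<longrightarrow> x = 0)" for S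
  have step: "total S" if SE: "S \<subseteq> E" and IH: "\<And>k. k \<in> S \<Longrightarrow> total {i \<in> S. less i k}" for S
    unfolding total_def
  proof (intro ballI impI, rule ccontr)
    fix x assume "x \<in> closure (span (y ` S))" and fx: "\<forall>i\<in>E. f i x = 0" and "x \<noteq> 0"
    then obtain z where z: "\<And>n. z n \<in> span (y ` S)" and lim: "z \<longlonglongrightarrow> x"
      unfolding closure_sequential by blast
    \<comment> \<open>A quarter leaves a gap: \<open>z m\<close> has norm more than \<open>3 / 4 * norm x\<close>, and the last step bounds it by half of \<open>norm x\<close>.\<close>
    obtain m where m: "norm (z n - x) < norm x / 4" if "m \<le> n" for n
      using LIMSEQ_D[OF lim, of "norm x / 4"] \<open>x \<noteq> 0\<close> by auto
    have "norm x \<le> norm (z m - x) + norm (z m)"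
      using norm_triangle_sub[of x "z m"] by (simp add: norm_minus_commute)
    with m[of m] have zm: "norm (z m) > 3 / 4 * norm x" by simp
    obtain T where T: "finite T" "T \<subseteq> S" "z m \<in> span (y ` T)"
    proof -
      obtain B where B: "finite B" "B \<subseteq> y ` S" "z m \<in> span B"
        using z[of m] unfolding span_explicit by (auto intro: span_sum span_scale span_base)
      then obtain T where "finite T" "T \<subseteq> S" "B = y ` T"
        by (meson finite_subset_image)
      with B that show thesis by blast
    qed
    have "T \<noteq> {}"
      using T(3) zm by auto
    then obtain k where k: "k \<in> T" "\<And>i. i \<in> T \<Longrightarrow> le i k"
      using T(1) wo.Max_in wo.Max_ge by blast
    have kS: "k \<in> S" and kE: "k \<in> E" using k T SE by auto
    have zm_in: "z m \<in> span (y ` {i \<in> E. le i k})"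
    proof -
      have "y ` T \<subseteq> y ` {i \<in> E. le i k}" using T(2) k(2) SE by auto
      from subsetD[OF span_mono[OF this] T(3)] show ?thesis .
    qed
    have "\<forall>n. \<exists>p q. p \<in> span (y ` {i \<in> S. le i k}) \<and> q \<in> span (y ` {i \<in> S. less k i}) \<and> z n = p + q"
    proof
      fix n
      have "y ` S = y ` {i \<in> S. le i k} \<union> y ` {i \<in> S. less k i}"
        by (auto simp flip: image_Un intro!: imageI simp: wo.not_le)
      then have "z n \<in> span (y ` {i \<in> S. le i k} \<union> y ` {i \<in> S. less k i})" using z[of n] by simp
      then show "\<exists>p q. p \<in> span (y ` {i \<in> S. le i k}) \<and> q \<in> span (y ` {i \<in> S. less k i}) \<and> z n = p + q"
        unfolding span_Un by blast
    qed
    from choice[OF this] obtain p where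
      "\<forall>n. \<exists>q. p n \<in> span (y ` {i \<in> S. le i k}) \<and> q \<in> span (y ` {i \<in> S. less k i}) \<and> z n = p n + q"
      by (elim exE)
    from choice[OF this] obtain q where pq:
      "\<forall>n. p n \<in> span (y ` {i \<in> S. le i k}) \<and> q n \<in> span (y ` {i \<in> S. less k i}) \<and> z n = p n + q n"
      by (elim exE)
    then have p: "\<And>n. p n \<in> span (y ` {i \<in> S. le i k})"
      and q: "\<And>n. q n \<in> span (y ` {i \<in> S. less k i})" and zpq: "\<And>n. z n = p n + q n"
      by simp_all
    have pE: "p n \<in> span (y ` {i \<in> E. le i k})" and qE: "q n \<in> span (y ` {i \<in> E. less k i})" for n
    proof -
      have "y ` {i \<in> S. le i k} \<subseteq> y ` {i \<in> E. le i k}" "y ` {i \<in> S. less k i} \<subseteq> y ` {i \<in> E. less k i}"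
        using SE by auto
      from subsetD[OF span_mono[OF this(1)] p[of n]] subsetD[OF span_mono[OF this(2)] q[of n]]
      show "p n \<in> span (y ` {i \<in> E. le i k})" "q n \<in> span (y ` {i \<in> E. less k i})" .
    qed
    have contract: "norm (p n - p l) \<le> norm (z n - z l)" for n l
      using monotone[OF kE span_diff[OF pE[of n] pE[of l]] span_diff[OF qE[of n] qE[of l]]]
      by (simp add: zpq algebra_simps)
    have "Cauchy p"
      unfolding Cauchy_iff
    proof (intro allI impI)
      fix e :: real assume "0 < e"
      then obtain N where "\<forall>a\<ge>N. \<forall>b\<ge>N. norm (z a - z b) < e"
        using LIMSEQ_imp_Cauchy[OF lim] unfolding Cauchy_iff by blast
      then show "\<exists>N. \<forall>a\<ge>N. \<forall>b\<ge>N. norm (p a - p b) < e"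
        using contract order_le_less_trans by blast
    qed
    then obtain w where w: "p \<longlonglongrightarrow> w"
      using Cauchy_convergent convergent_def by blast
    have fp: "f j (p n) = f j (z n)" if "j \<in> E" "le j k" for j n
    proof -
      have "j \<noteq> i" if "less k i" for i using \<open>le j k\<close> that by auto
      then have "f j a = 0" if "a \<in> y ` {i \<in> E. less k i}" for a
        using biorth[OF \<open>j \<in> E\<close>] that by auto
      then have "f j (q n) = 0"
        by (rule dual_ball_vanish_span[OF f[OF \<open>j \<in> E\<close>] _ qE])
      then show ?thesis by (simp add: zpq dual_ball_add[OF f[OF that(1)]])
    qed
    have fp0: "(\<lambda>n. f j (p n)) \<longlonglongrightarrow> 0" if "j \<in> E" for j
    proof (cases "le j k")
      case True
      have "(\<lambda>n. f j (z n)) \<longlonglongrightarrow> f j x" by (rule dual_ball_tendsto[OF f[OF that] lim])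
      with fx that True show ?thesis by (simp add: fp)
    next
      case False
      have "j \<noteq> i" if "le i k" for i using False that by auto
      then have "f j a = 0" if "a \<in> y ` {i \<in> E. le i k}" for a
        using biorth[OF \<open>j \<in> E\<close>] that by auto
      then have "f j (p n) = 0" for n
        by (rule dual_ball_vanish_span[OF f[OF \<open>j \<in> E\<close>] _ pE])
      then show ?thesis by simp
    qed
    have fw: "f j w = 0" if "j \<in> E" for j
      using LIMSEQ_unique[OF dual_ball_tendsto[OF f[OF that] w] fp0[OF that]] .
    have "\<forall>n. \<exists>c. p n - sc c (y k) \<in> span (y ` {i \<in> S. less i k})"
    proof
      fix n
      have "{i \<in> S. le i k} = insert k {i \<in> S. less i k}" using kS by auto
      then have "p n \<in> span (insert (y k) (y ` {i \<in> S. less i k}))" using p[of n] by simp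
      then show "\<exists>c. p n - sc c (y k) \<in> span (y ` {i \<in> S. less i k})"
        by (simp add: span_breakdown_eq)
    qed
    from choice[OF this] obtain c where "\<forall>n. p n - sc (c n) (y k) \<in> span (y ` {i \<in> S. less i k})"
      by (elim exE)
    then have c: "p n - sc (c n) (y k) \<in> span (y ` {i \<in> S. less i k})" for n by simp
    have "c n = f k (p n)" for n
    proof -
      have "f k a = 0" if "a \<in> y ` {i \<in> S. less i k}" for a
        using biorth[OF kE] that SE by auto
      then have "f k (p n - sc (c n) (y k)) = 0"
        by (rule dual_ball_vanish_span[OF f[OF kE] _ c])
      then show ?thesis
        using biorth[OF kE kE] by (simp add: dual_ball_diff[OF f[OF kE]] dual_ball_sc[OF f[OF kE]])
    qed
    with fp0[OF kE] have "(\<lambda>n. norm (c n) * norm (y k)) \<longlonglongrightarrow> 0"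
      by (intro tendsto_mult_left_zero tendsto_norm_zero) simp
    then have "(\<lambda>n. sc (c n) (y k)) \<longlonglongrightarrow> 0"
      unfolding norm_sc[symmetric] by (rule tendsto_norm_zero_cancel)
    from tendsto_diff[OF w this] c have "w \<in> closure (span (y ` {i \<in> S. less i k}))"
      unfolding closure_sequential by (intro exI[of _ "\<lambda>n. p n - sc (c n) (y k)"]) simp
    with IH[OF kS] fw have "w = 0" unfolding total_def by blast
    then have lim0: "(\<lambda>n. norm (p n - z m)) \<longlonglongrightarrow> norm (z m)"
      using tendsto_norm[OF tendsto_diff[OF w tendsto_const[of "z m"]]] by simp
    have "norm (p n - z m) \<le> norm x / 2" if "n \<ge> m" for n
    proof -
      have "norm (p n - z m) \<le> norm (z n - z m)"
        using monotone[OF kE span_diff[OF pE[of n] zm_in] qE[of n]]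
        by (simp add: zpq algebra_simps)
      also have "\<dots> \<le> norm (z n - x) + norm (z m - x)"
        using norm_triangle_ineq4[of "z n - x" "z m - x"] by simp
      finally show ?thesis using m[OF that] m[of m] by simp
    qed
    then have "norm (z m) \<le> norm x / 2"
      using LIMSEQ_le_const2[OF lim0] by blast
    with zm norm_ge_zero[of x] show False by linarith
  qed
  have "total {i \<in> E. less i k}" for k
  proof (induction k rule: wo.less_induct)
    case (less k)
    show ?case
    proof (rule step)
      fix j assume j: "j \<in> {i \<in> E. less i k}"
      then have "{i \<in> {i \<in> E. less i k}. less i j} = {i \<in> E. less i j}"
        using wo.less_trans by blast
      with less.IH[of j] j show "total {i \<in> {i \<in> E. less i k}. less i j}" by simp
    qed blast
  qed
  then have "total E" by (rule step[OF order_refl])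
  with x zero show "x = 0" unfolding total_def by blast
qed

section \<open>Monotone Auerbach systems\<close>

text \<open>Choose \<open>x\<close> greedily if the norming functionals of all combinations of earlier elements vanish at \<open>x\<close>. If
only \<open>r\<close> elements were chosen, then no non-zero vector could be killed by the norming functionals of all
elements of the span of \<open>L\<close>: it would have been chosen, although its own norming functional does not
vanish at it. Then a vector would be determined by the values of at most \<open>r\<close> functionals, so that the
space would have at most \<open>2 ^ r\<close> elements.\<close>

lemma large_kernel_set:
  fixes le lt :: "'a \<Rightarrow> 'a \<Rightarrow> bool" and r :: "'r rel"
  assumes wo: "class.wellorder le lt"
    and H: "\<And>z. H z \<in> dual_ball" "\<And>z. H z z = of_real (norm z)"
    and r: "Cinfinite r" and K: "|UNIV :: 'k set| \<le>o r"
    and big: "\<not> |UNIV :: 'a set| \<le>o ctwo ^c r"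
  shows "\<exists>L. \<not> |L| \<le>o r \<and> (\<forall>x\<in>L. \<forall>u\<in>span {t \<in> L. lt t x}. H u x = 0)"
proof -
  interpret wo: wellorder le lt by (rule wo)
  obtain L where L: "x \<in> L \<longleftrightarrow> x \<noteq> 0 \<and> (\<forall>u\<in>span (L \<inter> {t. lt t x}). H u x = 0)" for x
    using wo.greedy_set[of "\<lambda>B x. x \<noteq> 0 \<and> (\<forall>u\<in>span B. H u x = 0)"]
    unfolding wo.lessThan_def by blast
  have "\<not> |L| \<le>o r"
  proof
    assume "|L| \<le>o r"
    then have span: "|span L| \<le>o r" by (rule card_span_le[OF r K])
    have "\<exists>x. x \<noteq> 0 \<and> (\<forall>u\<in>span L. H u x = 0)"
    proof (rule ccontr)
      assume none: "\<not> ?thesis"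
      \<comment> \<open>The values of all these functionals at \<open>x\<close>, coded as a set of pairs.\<close>
      define graph where "graph x = (\<lambda>u. (u, H u x)) ` span L" for x
      have "inj graph"
      proof (rule injI)
        fix x x' assume "graph x = graph x'"
        then have "\<forall>u\<in>span L. H u x = H u x'" unfolding graph_def by blast
        then have "\<forall>u\<in>span L. H u (x - x') = 0" by (simp add: dual_ball_diff[OF H(1)])
        with none have "x - x' = 0" by blast
        then show "x = x'" by simp
      qed
      moreover have "graph ` UNIV \<subseteq> Pow (span L \<times> UNIV)" by (auto simp: graph_def)
      moreover have "|span L \<times> (UNIV :: 'k set)| \<le>o r"
        using span K r by (intro card_of_Times_ordLeq_infinite_Field) (auto simp: cinfinite_def)
      ultimately show False using card_le_two_power[OF r] big by blast
    qed
    then obtain x where x: "x \<noteq> 0" "\<And>u. u \<in> span L \<Longrightarrow> H u x = 0" by blast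
    have "x \<in> L"
      using x span_mono[of "L \<inter> {t. lt t x}" L] by (intro iffD2[OF L]) blast
    then have "H x x = 0" using x(2) span_base by blast
    with x(1) H(2) show False by simp
  qed
  moreover have "H u x = 0" if "x \<in> L" "u \<in> span {t \<in> L. lt t x}" for x u
    using iffD1[OF L that(1)] that(2) by (simp add: Int_def)
  ultimately show ?thesis by blast
qed

text \<open>The last condition says that the natural projections onto initial segments of the system have norm at most one on
the span of the system.\<close>

definition monotone_Auerbach_system ::
  "('a \<Rightarrow> 'a \<Rightarrow> bool) \<Rightarrow> ('a \<Rightarrow> 'a \<Rightarrow> bool) \<Rightarrow> 'a set \<Rightarrow> ('a \<Rightarrow> 'a) \<Rightarrow> ('a \<Rightarrow> 'a \<Rightarrow> 'k) \<Rightarrow> bool" where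
  "monotone_Auerbach_system le lt E y f \<longleftrightarrow>
     (\<forall>i\<in>E. f i \<in> dual_ball \<and> norm (y i) = 1) \<and>
     (\<forall>i\<in>E. \<forall>j\<in>E. f i (y j) = (if i = j then 1 else 0)) \<and>
     (\<forall>k\<in>E. \<forall>u\<in>span (y ` {i \<in> E. le i k}). \<forall>v\<in>span (y ` {i \<in> E. lt k i}). norm u \<le> norm (u + v))"

lemma monotone_Auerbach_system_subset:
  assumes "monotone_Auerbach_system le lt E y f" "E' \<subseteq> E"
  shows "monotone_Auerbach_system le lt E' y f"
proof -
  have "span (y ` {i \<in> E'. P i}) \<subseteq> span (y ` {i \<in> E. P i})" for P
    using assms(2) by (intro span_mono image_mono) auto
  then show ?thesis
    using assms unfolding monotone_Auerbach_system_def by (meson subsetD)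
qed

text \<open>The heart of the proof. On the set \<open>L\<close> above, \<open>H u\<close> vanishes at every element that comes after the vectors
of which \<open>u\<close> is a combination. This gives monotonicity for free, and also half of the orthogonality:
\<open>H (i - s i)\<close> kills whatever comes after \<open>s i\<close>. Its values at earlier elements need not vanish. But if
\<open>H (j - x) l\<close> has the same value \<open>d\<close> for all \<open>l < j < x\<close>, then \<open>H (j - x)\<close> kills differences of earlier elements. Hence the
normalised differences of disjoint consecutive pairs from a homogeneous set form an Auerbach system.\<close>

lemma exists_monotone_Auerbach_system:
  fixes le lt :: "'a \<Rightarrow> 'a \<Rightarrow> bool" and r :: "'r rel"
  assumes wo: "class.wellorder le lt"
    and H: "\<And>z. H z \<in> dual_ball" "\<And>z. H z z = of_real (norm z)"
    and r: "Cinfinite r" and K: "|UNIV :: 'k set| \<le>o r"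
    and big: "\<not> |UNIV :: 'a set| \<le>o ctwo ^c (ctwo ^c (ctwo ^c r))"
  shows "\<exists>E y f. \<not> |E| \<le>o r \<and> monotone_Auerbach_system le lt E y f"
proof -
  interpret wo: wellorder le lt by (rule wo)
  have two: "Cinfinite (ctwo ^c s) \<and> |UNIV :: 'k set| \<le>o ctwo ^c s"
    if "Cinfinite s" "|UNIV :: 'k set| \<le>o s" for s :: "'s rel"
    using that ordLeq_transitive[OF that(2) ordLess_imp_ordLeq[OF ordLess_ctwo_cexp]]
    by (auto intro!: Cinfinite_cexp simp: ordLeq_refl Card_order_ctwo)
  obtain L where L: "\<not> |L| \<le>o ctwo ^c (ctwo ^c r)"
    and ker: "\<And>x u. \<lbrakk>x \<in> L; u \<in> span {t \<in> L. lt t x}\<rbrakk> \<Longrightarrow> H u x = 0"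
    using large_kernel_set[OF wo H _ _ big] two[OF r K] two by blast
  from wo.Erdos_Rado_triples[OF r K L, of "\<lambda>l j x. H (j - x) l"]
  obtain G d where GL: "G \<subseteq> L" and G: "\<not> |G| \<le>o r"
    and hom: "\<forall>l\<in>G. \<forall>j\<in>G. \<forall>x\<in>G. lt l j \<and> lt j x \<longrightarrow> H (j - x) l = d"
    by (elim exE conjE)
  then have d: "H (j - x) l = d" if "l \<in> G" "j \<in> G" "x \<in> G" "lt l j" "lt j x" for l j x
    using that by simp
  from wo.disjoint_successor_pairs[OF r G] obtain E s where EG: "E \<subseteq> G" and E: "\<not> |E| \<le>o r"
    and Es: "\<forall>i\<in>E. s i \<in> G \<and> lt i (s i)" "\<forall>i\<in>E. \<forall>j\<in>E. lt i j \<longrightarrow> lt (s i) j"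
    by (elim exE conjE)
  have s: "s i \<in> G \<and> lt i (s i)" if "i \<in> E" for i
    using Es(1) that by simp
  have sep: "lt (s i) j" if "i \<in> E" "j \<in> E" "lt i j" for i j
    using Es(2) that by simp
  define z where "z i = i - s i" for i
  define y where "y i = sc (of_real (inverse (norm (z i)))) (z i)" for i
  have later: "H u t = 0" if "t \<in> L" "u \<in> span A" "\<And>a. a \<in> A \<Longrightarrow> a \<in> L \<and> lt a t" for t u A
    using ker[OF that(1), of u] span_mono[of A "{a \<in> L. lt a t}"] that by blast
  have inL: "i \<in> L" "s i \<in> L" if "i \<in> E" for i
    using that EG GL s by blast+
  have znz: "z i \<noteq> 0" if "i \<in> E" for i
    using s[OF that] by (auto simp: z_def)
  have z_span: "z i \<in> span {i, s i}" for i
    unfolding z_def by (intro span_diff span_base) auto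
  have Hz: "H (z i) (z j) = 0" if ij: "i \<in> E" "j \<in> E" "i \<noteq> j" for i j
  proof (cases "lt i j")
    case True
    have "H (z i) j = 0"
      using s[OF ij(1)] sep[OF ij(1,2) True] True inL ij
      by (intro later[OF _ z_span]) auto
    moreover have "H (z i) (s j) = 0"
      using s[OF ij(1)] s[OF ij(2)] sep[OF ij(1,2) True] True inL ij
      by (intro later[OF _ z_span]) (auto intro: wo.less_trans)
    ultimately show ?thesis by (simp add: z_def[of j] dual_ball_diff[OF H(1)])
  next
    case False
    then have ji: "lt j i" using ij(3) by auto
    have "H (z i) j = d" "H (z i) (s j) = d"
      unfolding z_def using ij EG s ji sep[OF ij(2,1) ji] by (auto intro!: d)
    then show ?thesis by (simp add: z_def[of j] dual_ball_diff[OF H(1)])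
  qed
  have "norm (y i) = 1" if "i \<in> E" for i
    using znz[OF that] by (simp add: y_def norm_sc norm_inverse)
  moreover have "H (z i) (y j) = (if i = j then 1 else 0)" if "i \<in> E" "j \<in> E" for i j
  proof -
    have "(of_real (inverse (norm (z i))) :: 'k) * of_real (norm (z i)) = 1"
      unfolding of_real_mult[symmetric] using znz[OF that(1)] by simp
    then show ?thesis
      using Hz[OF that]
      by (cases "i = j") (simp_all add: y_def dual_ball_sc[OF H(1)] H(2) del: of_real_inverse)
  qed
  moreover have "norm u \<le> norm (u + v)"
    if k: "k \<in> E" and u: "u \<in> span (y ` {i \<in> E. le i k})" and v: "v \<in> span (y ` {i \<in> E. lt k i})" for k u v
  proof -
    \<comment> \<open>All vectors that enter into \<open>u\<close>; they precede both members of any pair that enters into \<open>v\<close>.\<close>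
    define A where "A = (\<Union>i\<in>{i \<in> E. le i k}. {i, s i})"
    have "y i \<in> span A" if "i \<in> E" "le i k" for i
    proof -
      have "z i \<in> span A"
        using z_span[of i] span_mono[of "{i, s i}" A] that by (auto simp: A_def)
      then show ?thesis unfolding y_def by (rule span_scale)
    qed
    then have "span (y ` {i \<in> E. le i k}) \<subseteq> span A"
      by (intro span_minimal subspace_span) auto
    with u have uA: "u \<in> span A" by blast
    have Huy: "H u (y j) = 0" if j: "j \<in> E" "lt k j" for j
    proof -
      have A_less: "a \<in> L \<and> lt a j" if "a \<in> A" for a
      proof -
        obtain i where i: "i \<in> E" "le i k" "a = i \<or> a = s i" using \<open>a \<in> A\<close> by (auto simp: A_def)
        have "lt i j" using i(2) j(2) by (rule wo.le_less_trans)
        with sep[OF i(1) j(1)] i(3) inL[OF i(1)] show ?thesis by auto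
      qed
      have "H u j = 0" "H u (s j) = 0"
        using A_less inL[OF j(1)] s[OF j(1)] wo.less_trans by (blast intro: later[OF _ uA])+
      then show ?thesis by (simp add: y_def z_def dual_ball_sc[OF H(1)] dual_ball_diff[OF H(1)])
    qed
    have "H u v = 0"
      using Huy by (intro dual_ball_vanish_span[OF H(1) _ v]) auto
    then have "H u (u + v) = of_real (norm u)"
      by (simp add: dual_ball_add[OF H(1)] H(2))
    with dual_ball_norm[OF H(1), of u "u + v"] show ?thesis by simp
  qed
  ultimately have "monotone_Auerbach_system le lt E y (\<lambda>i. H (z i))"
    using H(1) unfolding monotone_Auerbach_system_def by blast
  with E show ?thesis by blast
qed

lemma Auerbach_basis_closed_span:
  fixes le lt :: "'a \<Rightarrow> 'a \<Rightarrow> bool"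
  assumes wo: "class.wellorder le lt" and sys: "monotone_Auerbach_system le lt E y f"
  defines "Y \<equiv> closure (span (y ` E))"
  shows "Auerbach_basis sc Y E y (\<lambda>i u. if u \<in> Y then f i u else 0)"
proof -
  interpret fm: module "\<lambda>c (f :: 'a \<Rightarrow> 'k) y. c * f y" by (rule module_functions)
  define g where "g i u = (if u \<in> Y then f i u else 0)" for i u
  have f: "f i \<in> dual_ball" and y1: "norm (y i) = 1" if "i \<in> E" for i
    using sys that unfolding monotone_Auerbach_system_def by blast+
  have biorth: "f i (y j) = (if i = j then 1 else 0)" if "i \<in> E" "j \<in> E" for i j
    using sys that unfolding monotone_Auerbach_system_def by blast
  have Y: "subspace Y" unfolding Y_def by (intro subspace_closure subspace_span)
  have yY: "y i \<in> Y" if "i \<in> E" for i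
    using that span_base[of "y i" "y ` E"] closure_subset unfolding Y_def by blast
  have g_dual: "g i \<in> dual_space sc Y" if "i \<in> E" for i
  proof -
    have "\<exists>B. \<forall>u\<in>Y. norm (g i u) \<le> B * norm u"
      using dual_ball_norm[OF f[OF that]] by (intro exI[of _ 1]) (simp add: g_def)
    moreover have "g i (u + v) = g i u + g i v" if "u \<in> Y" "v \<in> Y" for u v
      using subspace_add[OF Y that] that by (simp add: g_def dual_ball_add[OF f[OF \<open>i \<in> E\<close>]])
    moreover have "g i (sc c u) = c * g i u" if "u \<in> Y" for c u
      using subspace_scale[OF Y that] that by (simp add: g_def dual_ball_sc[OF f[OF \<open>i \<in> E\<close>]])
    ultimately show ?thesis unfolding dual_space_def by (simp add: g_def)
  qed
  have "dual_space sc Y \<subseteq> weak_star sc Y closure_of (fm.span (g ` E))"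
  proof (rule weak_star_dense_if_total[OF Y])
    show "fun_subspace (fm.span (g ` E))" by (rule fm.subspace_span)
    show "fm.span (g ` E) \<subseteq> dual_space sc Y"
      using g_dual by (intro fm.span_minimal fun_subspace_dual_space Y) auto
    fix u assume u: "u \<in> Y" and zero: "\<And>h. h \<in> fm.span (g ` E) \<Longrightarrow> h u = 0"
    have zero: "f i u = 0" if "i \<in> E" for i
      using zero[of "g i"] fm.span_base[of "g i" "g ` E"] u that by (simp add: g_def)
    show "u = 0"
    proof (rule total_on_closed_span[OF wo f biorth _ _ zero])
      show "u \<in> closure (span (y ` E))" using u by (simp only: Y_def)
      show "norm p \<le> norm (p + q)"
        if "k \<in> E" "p \<in> span (y ` {i \<in> E. le i k})" "q \<in> span (y ` {i \<in> E. lt k i})" for k p q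
        using sys that unfolding monotone_Auerbach_system_def by blast
    qed
  qed
  moreover have "dual_norm Y (g i) = 1" if i: "i \<in> E" for i
  proof -
    have le1: "norm (g i u) \<le> 1" if "u \<in> {u \<in> Y. norm u \<le> 1}" for u
      using dual_ball_norm[OF f[OF i], of u] that by (simp add: g_def)
    have "norm (g i (y i)) = 1" "y i \<in> {u \<in> Y. norm u \<le> 1}"
      using biorth[OF i i] yY[OF i] y1[OF i] by (simp_all add: g_def)
    with le1 show ?thesis
      unfolding dual_norm_def by (intro cSup_eq_maximum) (auto intro: rev_image_eqI)
  qed
  moreover have "g i (y j) = (if i = j then 1 else 0)" if "i \<in> E" "j \<in> E" for i j
    using biorth[OF that] yY[OF that(2)] by (simp add: g_def)
  ultimately have "Auerbach_basis sc Y E y g"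
    using yY g_dual y1 unfolding Auerbach_basis_def M_basis_def by (auto simp: Y_def)
  then show ?thesis unfolding g_def .
qed

text \<open>The vectors \<open>y i\<close> have mutual distance at least \<open>f i (y i - y j) = 1\<close>, so a dense set needs as many points
as there are indices; conversely the linear span is a dense set of at most that size.\<close>

lemma dens_closed_span:
  fixes le lt :: "'a \<Rightarrow> 'a \<Rightarrow> bool" and r :: "'r rel"
  assumes sys: "monotone_Auerbach_system le lt E y f"
    and r: "Cinfinite r" and K: "|UNIV :: 'k set| \<le>o r" and E: "|E| =o r"
  shows "dens (closure (span (y ` E))) =o r"
proof -
  let ?Y = "closure (span (y ` E))"
  have f: "f i \<in> dual_ball" if "i \<in> E" for i
    using sys that unfolding monotone_Auerbach_system_def by blast
  have biorth: "f i (y j) = (if i = j then 1 else 0)" if "i \<in> E" "j \<in> E" for i j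
    using sys that unfolding monotone_Auerbach_system_def by blast
  have "|y ` E| \<le>o r"
    using card_of_image ordLeq_ordIso_trans[OF _ E] by blast
  then have "|span (y ` E)| \<le>o r" by (rule card_span_le[OF r K])
  moreover have "dens ?Y \<le>o |span (y ` E)|"
    by (rule dens_le) (simp_all add: closure_subset)
  ultimately have upper: "dens ?Y \<le>o r" using ordLeq_transitive by blast
  obtain D where D: "D \<subseteq> ?Y" "?Y \<subseteq> closure D" "dens ?Y = |D|"
    using dens_attained by blast
  have "\<exists>x\<in>D. dist x (y i) < 1 / 2" if "i \<in> E" for i
  proof -
    have "y i \<in> closure D"
      using that span_base[of "y i" "y ` E"] closure_subset[of "span (y ` E)"] D(2) by blast
    from this[unfolded closure_approachable, rule_format, of "1 / 2"] show ?thesis by simp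
  qed
  then obtain p where p: "\<And>i. i \<in> E \<Longrightarrow> p i \<in> D \<and> dist (p i) (y i) < 1 / 2"
    by metis
  have "inj_on p E"
  proof (rule inj_onI, rule ccontr)
    fix i j assume ij: "i \<in> E" "j \<in> E" "p i = p j" "i \<noteq> j"
    have "f i (y i - y j) = 1"
      using biorth ij by (simp add: dual_ball_diff[OF f])
    then have "1 \<le> dist (y i) (y j)"
      using dual_ball_norm[OF f[OF ij(1)], of "y i - y j"] by (simp add: dist_norm)
    also have "\<dots> \<le> dist (p i) (y i) + dist (p j) (y j)"
      using dist_triangle3[of "y i" "y j" "p i"] ij(3) by simp
    finally show False using p[OF ij(1)] p[OF ij(2)] by simp
  qed
  then have "|E| \<le>o |D|" using p card_of_ordLeq by blast
  then have "r \<le>o dens ?Y"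
    unfolding D(3) using ordIso_ordLeq_trans[OF ordIso_symmetric[OF E]] by blast
  with upper show ?thesis by (simp add: ordIso_iff_ordLeq)
qed

text \<open>The construction over either scalar field: only norming functionals and the size of the field enter.\<close>

theorem subspace_with_Auerbach_basis:
  fixes \<kappa> :: "'c rel"
  assumes norming: "\<And>z. \<exists>f\<in>dual_ball. f z = of_real (norm z)"
    and wo: "class.wellorder (le :: 'a \<Rightarrow> 'a \<Rightarrow> bool) lt"
    and \<kappa>: "Cinfinite \<kappa>" and K: "|UNIV :: 'k set| \<le>o \<kappa>"
    and big: "ctwo ^c (ctwo ^c (ctwo ^c \<kappa>)) <o dens (UNIV :: 'a set)"
  shows "\<exists>Y. subspace Y \<and> closed Y \<and> has_Auerbach_basis sc Y \<and> dens Y =o cardSuc \<kappa>"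
proof -
  have "dens (UNIV :: 'a set) \<le>o |UNIV :: 'a set|" by (rule dens_le) simp_all
  with big have "ctwo ^c (ctwo ^c (ctwo ^c \<kappa>)) <o |UNIV :: 'a set|" by (rule ordLess_ordLeq_trans)
  then have big': "\<not> |UNIV :: 'a set| \<le>o ctwo ^c (ctwo ^c (ctwo ^c \<kappa>))" by (rule not_ordLess_ordLeq)
  from norming have "\<forall>z. \<exists>f. f \<in> dual_ball \<and> f z = of_real (norm z)" by blast
  from choice[OF this] obtain H where "\<forall>z. H z \<in> dual_ball \<and> H z z = of_real (norm z)"
    by (elim exE)
  then have H: "H z \<in> dual_ball" "H z z = of_real (norm z)" for z by simp_all
  from exists_monotone_Auerbach_system[OF wo H \<kappa> K big'] obtain E y f
    where E: "\<not> |E| \<le>o \<kappa>" and sys: "monotone_Auerbach_system le lt E y f"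
    by (elim exE conjE)
  have "cardSuc \<kappa> \<le>o |E|"
    using E \<kappa> by (simp add: cardSuc_ordLess_ordLeq[symmetric] card_of_Card_order
        not_ordLeq_iff_ordLess card_of_Well_order card_order_on_well_order_on)
  then obtain E' where E': "E' \<subseteq> E" "|E'| =o cardSuc \<kappa>"
    using subset_of_card_order cardSuc_Card_order \<kappa> by blast
  note sys' = monotone_Auerbach_system_subset[OF sys E'(1)]
  have K': "|UNIV :: 'k set| \<le>o cardSuc \<kappa>"
    using K cardSuc_ordLeq \<kappa> ordLeq_transitive by blast
  let ?Y = "closure (span (y ` E'))"
  have "has_Auerbach_basis sc ?Y"
    using Auerbach_basis_closed_span[OF wo sys'] by (rule has_Auerbach_basisI)
  moreover have "dens ?Y =o cardSuc \<kappa>"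
    using dens_closed_span[OF sys' _ K' E'(2)] Cinfinite_cardSuc[OF \<kappa>] by blast
  moreover have "subspace ?Y" by (intro subspace_closure subspace_span)
  ultimately show ?thesis by blast
qed

end

section \<open>Subspaces with an Auerbach basis\<close>

theorem corollary3p2:
  fixes \<kappa> :: "'c rel"
  assumes "Card_order \<kappa>"
    and "|UNIV :: real set| \<le>o \<kappa>"
    and "ctwo ^c (ctwo ^c (ctwo ^c \<kappa>)) <o dens (UNIV :: 'a::banach set)"
  shows
    "(\<exists>Y :: 'a::banach set. subspace Y \<and> closed Y \<and>
        has_Auerbach_basis (scaleR :: real \<Rightarrow> 'a::banach \<Rightarrow> 'a) Y \<and> dens Y =o cardSuc \<kappa>) \<and>
     (\<forall>scaleC :: complex \<Rightarrow> 'a::banach \<Rightarrow> 'a. normed_scaling scaleC \<longrightarrow>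
       (\<exists>Y :: 'a::banach set. module.subspace scaleC Y \<and> closed Y \<and>
          has_Auerbach_basis scaleC Y \<and> dens Y =o cardSuc \<kappa>))"
proof -
  have "|UNIV :: real set| \<le>o |Field \<kappa>|"
    using assms(2) ordLeq_ordIso_trans[OF _ ordIso_symmetric[OF card_of_Field_ordIso[OF assms(1)]]]
    by blast
  then have "infinite (Field \<kappa>)"
    using card_of_ordLeq_infinite[of "UNIV :: real set"] by (simp add: infinite_UNIV_char_0)
  then have \<kappa>: "Cinfinite \<kappa>"
    using assms(1) by (simp add: cinfinite_def)
  obtain le lt :: "'a \<Rightarrow> 'a \<Rightarrow> bool" where wo: "class.wellorder le lt"
    using exists_wellorder by blast
  have "\<exists>Y :: 'a set. subspace Y \<and> closed Y \<and>
      has_Auerbach_basis (scaleR :: real \<Rightarrow> 'a \<Rightarrow> 'a) Y \<and> dens Y =o cardSuc \<kappa>"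
  proof -
    interpret R: banach_scaling "scaleR :: real \<Rightarrow> 'a \<Rightarrow> 'a"
      unfolding banach_scaling_def by (rule normed_scaling_scaleR)
    have "\<exists>f\<in>R.dual_ball. f z = of_real (norm z)" for z
    proof -
      obtain f where "linear f" "\<forall>u. \<bar>f u\<bar> \<le> norm u" "f z = norm z"
        using norming_functional[of z] by blast
      then have "f \<in> R.dual_ball" "f z = of_real (norm z)"
        by (simp_all add: R.dual_ball_def linear_add linear_scale)
      then show ?thesis by blast
    qed
    from R.subspace_with_Auerbach_basis[OF this wo \<kappa> assms(2,3)]
    show ?thesis unfolding subspace_raw_def .
  qed
  moreover have "\<exists>Y :: 'a set. module.subspace scaleC Y \<and> closed Y \<and>
      has_Auerbach_basis scaleC Y \<and> dens Y =o cardSuc \<kappa>"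
    if C: "normed_scaling scaleC" for scaleC :: "complex \<Rightarrow> 'a \<Rightarrow> 'a"
  proof -
    interpret C: banach_scaling scaleC
      unfolding banach_scaling_def by (rule C)
    show ?thesis
      by (rule C.subspace_with_Auerbach_basis[OF norming_functional_complex[OF C] wo \<kappa>
            ordLeq_transitive[OF card_complex_le_real assms(2)] assms(3)])
  qed
  ultimately show ?thesis by blast
qed

end
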